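(* Let $X,Y$ be Banach spaces, $T$ an arbitrary index set, $g_t:X\to(-\infty,\infty]$ ($t\in T$) and $h:X\to Y$, let $\Omega:=\{x\in X : h(x)=0,\ g_t(x)\le 0 \text{ for all } t\in T\}$ and $\bar x\in\Omega$, and let the standing assumptions (SA) hold at $\bar x$. Suppose that the system $\{g_t(x)\le 0\ (t\in T),\ h(x)=0\}$ satisfies the PMFCQ at $\bar x$ and that the functions $g_t$, $t\in T$, are uniformly Fréchet differentiable at $\bar x$. Then the Fréchet normal cone to $\Omega$ at $\bar x$ is $$\widehat N(\bar x;\Omega)=\Big(\bigcap_{\varepsilon>0}\mathrm{cl}^*\,\mathrm{cone}\{\nabla g_t(\bar x) : t\in T_\varepsilon(\bar x)\}\Big)+\nabla h(\bar x)^*(Y^* ).$$ If furthermore the functions $g_t$, $t\in T$, are uniformly strictly differentiable at $\bar x$, then the limiting normal cone to $\Omega$ at $\bar x$ is also given by $$N(\bar x;\Omega)=\Big(\bigcap_{\varepsilon>0}\mathrm{cl}^*\,\mathrm{cone}\{\nabla g_t(\bar x) : t\in T_\varepsilon(\bar x)\}\Big)+\nabla h(\bar x)^*(Y^* ),$$ and thus $\Omega$ is normally regular at $\bar x$, i.e. $\widehat N(\bar x;\Omega)=N(\bar x;\Omega)$.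
   Context: $X^*,Y^*$ are the topological duals, $\langle\cdot,\cdot\rangle$ is the canonical pairing, $\mathbb B_r(x)$ is the closed ball of radius $r$ centered at $x$. For a set $S$, $\mathrm{cone}\,S$ is the convex cone generated by $S\cup\{0\}$; $\mathrm{cl}^*$ is the closure in the weak$^*$ topology. $\nabla h(\bar x)^*:Y^*\to X^*$ is the adjoint of $\nabla h(\bar x)$. Standing assumptions (SA) at $\bar x$: each $g_t$, $t\in T$, is Fréchet differentiable at $\bar x$; the set $\{\nabla g_t(\bar x): t\in T\}$ is bounded in $X^*$; $h$ is strictly differentiable at $\bar x$, i.e. there is a continuous linear operator $\nabla h(\bar x):X\to Y$ with $\lim_{x,x'\to\bar x}\frac{h(x)-h(x')-\nabla h(\bar x)(x-x')}{\|x-x'\|}=0$. Uniform Fréchet differentiability of $\{g_t\}_{t\in T}$ at $\bar x$: $s(\eta):=\sup_{t\in T}\sup_{x\in \mathbb B_\eta(\bar x),\,x\ne\bar x}\frac{|g_t(x)-g_t(\bar x)-\langle\nabla g_t(\bar x),x-\bar x\rangle|}{\|x-\bar x\|}\to0$ as $\eta\downarrow0$. Uniform strict differentiability of $\{g_t\}_{t\in T}$ at $\bar x$: $r(\eta):=\sup_{t\in T}\sup_{x,x'\in \mathbb B_\eta(\bar x),\,x\ne x'}\frac{|g_t(x)-g_t(x')-\langle\nabla g_t(\bar x),x-x'\rangle|}{\|x-x'\|}\to0$ as $\eta\downarrow0$. $T_\varepsilon(\bar x):=\{t\in T: g_t(\bar x)\ge-\varepsilon\}$. PMFCQ (Perturbed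 Mangasarian-Fromovitz Constraint Qualification) at $\bar x$: $\nabla h(\bar x)$ is surjective and there is $\tilde x\in X$ with $\nabla h(\bar x)\tilde x=0$ and $\inf_{\varepsilon>0}\sup_{t\in T_\varepsilon(\bar x)}\langle\nabla g_t(\bar x),\tilde x\rangle<0$ (with $\sup\emptyset=-\infty$). For $\varphi:X\to(-\infty,\infty]$, $\bar x\in\mathrm{dom}\,\varphi$ and $\varepsilon\ge0$, $\widehat\partial_\varepsilon\varphi(\bar x):=\{x^*\in X^*:\liminf_{x\to\bar x}\frac{\varphi(x)-\varphi(\bar x)-\langle x^*,x-\bar x\rangle}{\|x-\bar x\|}\ge-\varepsilon\}$, and $\widehat\partial_\varepsilon\varphi(\bar x):=\emptyset$ if $\varphi(\bar x)=\infty$; $\widehat\partial\varphi:=\widehat\partial_0\varphi$. The limiting subdifferential $\partial\varphi(\bar x)$ is the set of $x^*\in X^*$ for which there exist sequences $x_n\to\bar x$ with $\varphi(x_n)\to\varphi(\bar x)$, $\varepsilon_n\downarrow0$ and $x_n^*\in\widehat\partial_{\varepsilon_n}\varphi(x_n)$ with $x_n^*\to x^*$ weak$^*$. With $\delta(x;\Omega)=0$ for $x\in\Omega$ and $\infty$ otherwise, the Fréchet and limiting normal cones are $\widehat N(\bar x;\Omega):=\widehat\partial\delta(\bar x;\Omega)$ and $N(\bar x;\Omega):=\partial\delta(\bar x;\Omega)$. *)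

theory Defs
  imports "HOL-Analysis.Analysis" "HOL-Library.Set_Algebras"
begin

text \<open>
  The dual \<open>X\<^sup>*\<close> is the type \<open>'x \<Rightarrow>\<^sub>L real\<close> of bounded linear functionals. On it, the
  strong operator topology (pointwise convergence) is exactly the weak* topology.
\<close>

abbreviation weak_star :: "('x::real_normed_vector \<Rightarrow>\<^sub>L real) topology" where
  "weak_star \<equiv> strong_operator_topology"

definition adjoint_map ::
  "('x::real_normed_vector \<Rightarrow>\<^sub>L 'y::real_normed_vector) \<Rightarrow> ('y \<Rightarrow>\<^sub>L real) \<Rightarrow> ('x \<Rightarrow>\<^sub>L real)" where
  "adjoint_map A = (\<lambda>y'. y' o\<^sub>L A)"

definition generated_cone :: "'a::real_vector set \<Rightarrow> 'a set" where
  "generated_cone S = convex_cone hull (insert 0 S)"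

text \<open>
  A finite limit of the difference quotient at \<open>xbar\<close> forces an extended-real-valued function
  to be finite near \<open>xbar\<close>; with that made explicit, the derivative is that of its real part.
\<close>

definition has_frechet_gradient ::
  "('x::real_normed_vector \<Rightarrow> ereal) \<Rightarrow> ('x \<Rightarrow>\<^sub>L real) \<Rightarrow> 'x \<Rightarrow> bool" where
  "has_frechet_gradient f D xbar \<longleftrightarrow>
     (\<forall>\<^sub>F x in nhds xbar. \<bar>f x\<bar> \<noteq> \<infinity>) \<and>
     ((\<lambda>x. real_of_ereal (f x)) has_derivative blinfun_apply D) (at xbar)"

definition has_strict_derivative ::
  "('x::real_normed_vector \<Rightarrow> 'y::real_normed_vector) \<Rightarrow> ('x \<Rightarrow>\<^sub>L 'y) \<Rightarrow> 'x \<Rightarrow> bool" where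
  "has_strict_derivative h A xbar \<longleftrightarrow>
     ((\<lambda>(x, x'). (h x - h x' - A (x - x')) /\<^sub>R norm (x - x')) \<longlongrightarrow> 0)
       (at (xbar, xbar) within {(x, x'). x \<noteq> x'})"

text \<open>
  The two moduli below are suprema of nonnegative quantities, taken in \<open>[0,\<infinity>]\<close>; thus the supremum
  of the empty set is \<open>0\<close> (relevant if \<open>T\<close> is empty or the space is trivial).
\<close>

definition frechet_modulus ::
  "'t set \<Rightarrow> ('t \<Rightarrow> 'x::real_normed_vector \<Rightarrow> ereal) \<Rightarrow> ('t \<Rightarrow> 'x \<Rightarrow>\<^sub>L real) \<Rightarrow> 'x \<Rightarrow> real \<Rightarrow> ennreal" where
  "frechet_modulus T g dg xbar \<eta> =
     (SUP t\<in>T. SUP x\<in>cball xbar \<eta> - {xbar}.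
        e2ennreal (\<bar>g t x - g t xbar - ereal (dg t (x - xbar))\<bar> / ereal (norm (x - xbar))))"

definition strict_modulus ::
  "'t set \<Rightarrow> ('t \<Rightarrow> 'x::real_normed_vector \<Rightarrow> ereal) \<Rightarrow> ('t \<Rightarrow> 'x \<Rightarrow>\<^sub>L real) \<Rightarrow> 'x \<Rightarrow> real \<Rightarrow> ennreal" where
  "strict_modulus T g dg xbar \<eta> =
     (SUP t\<in>T. SUP (x, x')\<in>{(x, x'). x \<in> cball xbar \<eta> \<and> x' \<in> cball xbar \<eta> \<and> x \<noteq> x'}.
        e2ennreal (\<bar>g t x - g t x' - ereal (dg t (x - x'))\<bar> / ereal (norm (x - x'))))"

definition uniformly_frechet_differentiable ::
  "'t set \<Rightarrow> ('t \<Rightarrow> 'x::real_normed_vector \<Rightarrow> ereal) \<Rightarrow> ('t \<Rightarrow> 'x \<Rightarrow>\<^sub>L real) \<Rightarrow> 'x \<Rightarrow> bool" where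
  "uniformly_frechet_differentiable T g dg xbar \<longleftrightarrow>
     (frechet_modulus T g dg xbar \<longlongrightarrow> 0) (at_right 0)"

definition uniformly_strictly_differentiable ::
  "'t set \<Rightarrow> ('t \<Rightarrow> 'x::real_normed_vector \<Rightarrow> ereal) \<Rightarrow> ('t \<Rightarrow> 'x \<Rightarrow>\<^sub>L real) \<Rightarrow> 'x \<Rightarrow> bool" where
  "uniformly_strictly_differentiable T g dg xbar \<longleftrightarrow>
     (strict_modulus T g dg xbar \<longlongrightarrow> 0) (at_right 0)"

definition feasible_set ::
  "'t set \<Rightarrow> ('t \<Rightarrow> 'x \<Rightarrow> ereal) \<Rightarrow> ('x \<Rightarrow> 'y::zero) \<Rightarrow> 'x set" where
  "feasible_set T g h = {x. h x = 0 \<and> (\<forall>t\<in>T. g t x \<le> 0)}"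

text \<open>
  The derivatives \<open>dg t\<close> (standing for \<open>\<nabla>g\<^sub>t(xbar)\<close>) and \<open>dh\<close> (standing for \<open>\<nabla>h(xbar)\<close>) are
  passed explicitly; they are uniquely determined by the differentiability conditions.
\<close>

definition standing_assumptions ::
  "'t set \<Rightarrow> ('t \<Rightarrow> 'x::real_normed_vector \<Rightarrow> ereal) \<Rightarrow> ('x \<Rightarrow> 'y::real_normed_vector)
    \<Rightarrow> ('t \<Rightarrow> 'x \<Rightarrow>\<^sub>L real) \<Rightarrow> ('x \<Rightarrow>\<^sub>L 'y) \<Rightarrow> 'x \<Rightarrow> bool" where
  "standing_assumptions T g h dg dh xbar \<longleftrightarrow>
     (\<forall>t\<in>T. has_frechet_gradient (g t) (dg t) xbar) \<and>
     bounded (dg ` T) \<and>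
     has_strict_derivative h dh xbar"

definition active_indices ::
  "'t set \<Rightarrow> ('t \<Rightarrow> 'x \<Rightarrow> ereal) \<Rightarrow> 'x \<Rightarrow> real \<Rightarrow> 't set" where
  "active_indices T g xbar \<epsilon> = {t\<in>T. g t xbar \<ge> ereal (- \<epsilon>)}"

definition PMFCQ ::
  "'t set \<Rightarrow> ('t \<Rightarrow> 'x::real_normed_vector \<Rightarrow> ereal) \<Rightarrow> ('t \<Rightarrow> 'x \<Rightarrow>\<^sub>L real)
    \<Rightarrow> ('x \<Rightarrow>\<^sub>L 'y::real_normed_vector) \<Rightarrow> 'x \<Rightarrow> bool" where
  "PMFCQ T g dg dh xbar \<longleftrightarrow>
     surj (blinfun_apply dh) \<and>
     (\<exists>xt. dh xt = 0 \<and>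
        (INF \<epsilon>\<in>{0<..}. SUP t\<in>active_indices T g xbar \<epsilon>. ereal (dg t xt)) < 0)"

definition frechet_subdifferential ::
  "real \<Rightarrow> ('x::real_normed_vector \<Rightarrow> ereal) \<Rightarrow> 'x \<Rightarrow> ('x \<Rightarrow>\<^sub>L real) set" where
  "frechet_subdifferential \<epsilon> \<phi> xbar =
     (if \<phi> xbar = \<infinity> then {}
      else {x'. Liminf (at xbar)
                  (\<lambda>x. (\<phi> x - \<phi> xbar - ereal (blinfun_apply x' (x - xbar))) / ereal (norm (x - xbar)))
                \<ge> ereal (- \<epsilon>)})"

definition limiting_subdifferential ::
  "('x::real_normed_vector \<Rightarrow> ereal) \<Rightarrow> 'x \<Rightarrow> ('x \<Rightarrow>\<^sub>L real) set" where
  "limiting_subdifferential \<phi> xbar =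
     {x'. \<exists>(xs :: nat \<Rightarrow> 'x) (\<epsilon> :: nat \<Rightarrow> real) (xs' :: nat \<Rightarrow> 'x \<Rightarrow>\<^sub>L real).
        xs \<longlonglongrightarrow> xbar \<and> (\<lambda>n. \<phi> (xs n)) \<longlonglongrightarrow> \<phi> xbar \<and>
        (\<forall>n. \<epsilon> n \<ge> 0) \<and> decseq \<epsilon> \<and> \<epsilon> \<longlonglongrightarrow> 0 \<and>
        (\<forall>n. xs' n \<in> frechet_subdifferential (\<epsilon> n) \<phi> (xs n)) \<and>
        limitin weak_star xs' x' sequentially}"

definition set_indicator :: "'x set \<Rightarrow> 'x \<Rightarrow> ereal" where
  "set_indicator \<Omega> x = (if x \<in> \<Omega> then 0 else \<infinity>)"

definition frechet_normal_cone ::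
  "'x::real_normed_vector \<Rightarrow> 'x set \<Rightarrow> ('x \<Rightarrow>\<^sub>L real) set" where
  "frechet_normal_cone xbar \<Omega> = frechet_subdifferential 0 (set_indicator \<Omega>) xbar"

definition limiting_normal_cone ::
  "'x::real_normed_vector \<Rightarrow> 'x set \<Rightarrow> ('x \<Rightarrow>\<^sub>L real) set" where
  "limiting_normal_cone xbar \<Omega> = limiting_subdifferential (set_indicator \<Omega>) xbar"

definition normally_regular :: "'x::real_normed_vector set \<Rightarrow> 'x \<Rightarrow> bool" where
  "normally_regular \<Omega> xbar \<longleftrightarrow> frechet_normal_cone xbar \<Omega> = limiting_normal_cone xbar \<Omega>"

end

theory Submission
  imports Defs
begin

text \<open>
  Call a direction critical if, for some \<open>\<epsilon> > 0\<close>, no gradient of an \<open>\<epsilon>\<close>-active constraint is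
  positive on it. These directions form a convex cone \<open>K\<close>, and the bipolar theorem
  identifies the intersection of the weak* closed cones in the formula with the polar cone of \<open>K\<close>
  (\<open>weak_star_closure_generated_cone\<close>). The vector \<open>xt\<close> from the qualification condition is an
  interior point of \<open>K\<close>, as the gradients are bounded, and it lies in the kernel of \<open>dh\<close>.

  The Frechet normal cone, and under uniform strict differentiability also the limiting one, consists
  of the functionals that are nonpositive on the critical directions in the kernel of \<open>dh\<close>. To see
  that normals have this property, perturb such a direction by a small multiple of \<open>xt\<close>. Then the
  nearly active constraints decrease at a uniform rate, the remaining ones stay negative,
  and the Lyusternik-Graves theorem corrects the error in the equation at a higher-order cost. The
  feasible curves obtained in this way exist uniformly for all base points at which the linearization is
  uniform (\<open>feasible_curve\<close>), and testing normals along them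
  proves the inequality, also for weak* limits of approximate normals at nearby points
  (\<open>limit_of_normals_nonpositive\<close>). The Frechet cone is the case of a constant base point.

  Such a functional is a sum as in the formula because \<open>xt\<close> is interior to \<open>K\<close>: its
  restriction to the kernel extends to a functional that is nonpositive on all of \<open>K\<close>
  (\<open>nonpositive_functional_extension\<close>), and the difference vanishes on the kernel of the surjective
  \<open>dh\<close>, hence is in the range of the adjoint. Conversely, a functional in the polar of \<open>K\<close> is a normal
  because \<open>x - xbar\<close>, for feasible \<open>x\<close>, is moved into \<open>K\<close> by a multiple of \<open>xt\<close> of size
  \<open>\<epsilon> + o(norm (x - xbar))\<close>, where \<open>\<epsilon>\<close> is arbitrarily small
  (\<open>polar_plus_adjoint_subset_frechet_normal_cone\<close>).
\<close>

section \<open>Uniform boundedness and open mappings\<close>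

lemma countable_closed_cover_has_interior:
  fixes F :: "nat \<Rightarrow> 'a::banach set"
  assumes closed: "\<And>k. closed (F k)" and cover: "(\<Union>k. F k) = UNIV"
  obtains k x r where "r > 0" "cball x r \<subseteq> F k"
proof -
  have "\<exists>k. interior (F k) \<noteq> {}"
  proof (rule ccontr)
    assume "\<not> ?thesis"
    then have "euclidean interior_of \<Union>(range F) = {}"
      by (intro Baire_category_alt)
        (auto simp: completely_metrizable_space_euclidean closed)
    then show False using cover by simp
  qed
  then obtain k x where "x \<in> interior (F k)" by blast
  then show thesis using that by (meson mem_interior_cball)
qed

text \<open>
  If the functionals are bounded by \<open>k\<close> on a ball of radius \<open>r\<close>, then they are bounded by
  \<open>2 * k / r\<close> on the unit ball, since every small vector is a difference of two points of that ball.
\<close>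
lemma uniform_boundedness:
  fixes f :: "nat \<Rightarrow> 'a::banach \<Rightarrow>\<^sub>L 'b::real_normed_vector"
  assumes "\<And>x. bounded (range (\<lambda>n. f n x))"
  obtains M where "\<And>n. norm (f n) \<le> M"
proof -
  define F where "F k = {x. \<forall>n. norm (f n x) \<le> real k}" for k :: nat
  have F_Inter: "F k = (\<Inter>n. {x. norm (f n x) \<le> real k})" for k
    by (auto simp: F_def)
  have closed: "closed (F k)" for k
    unfolding F_Inter by (intro closed_INT ballI closed_Collect_le continuous_intros)
  have "x \<in> (\<Union>k. F k)" for x
  proof -
    obtain a where a: "\<And>n. norm (f n x) \<le> a"
      using assms[of x] by (auto simp: bounded_iff)
    obtain k :: nat where "a \<le> real k" using real_arch_simple by blast
    with a have "x \<in> F k" by (auto simp: F_def intro: order_trans)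
    then show ?thesis by blast
  qed
  then have "(\<Union>k. F k) = UNIV" by blast
  with closed obtain k x r where r: "r > 0" and ball: "cball x r \<subseteq> F k"
    by (rule countable_closed_cover_has_interior)
  have "norm (f n) \<le> 2 * real k / r" for n
  proof (rule norm_blinfun_bound)
    fix z
    show "norm (f n z) \<le> 2 * real k / r * norm z"
    proof (cases "z = 0")
      case False
      define u where "u = (r / norm z) *\<^sub>R z"
      have "x + u \<in> cball x r" "x \<in> cball x r" using r False by (simp_all add: u_def dist_norm)
      then have "x + u \<in> F k" "x \<in> F k" using ball by blast+
      then have "norm (f n (x + u)) \<le> k" "norm (f n x) \<le> k" by (auto simp: F_def)
      moreover have "f n u = f n (x + u) - f n x" by (simp add: blinfun.add_right)
      ultimately have "norm (f n u) \<le> 2 * k"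
        using norm_triangle_ineq4[of "f n (x + u)" "f n x"] by simp
      then show ?thesis
        using r False by (simp add: u_def blinfun.scaleR_right field_simps)
    qed simp
  qed (use r in simp)
  then show thesis by (rule that)
qed

text \<open>
  The images of the balls of radius \<open>k\<close> cover the space, so the closure of one of them has an
  interior point; differences of its elements approximate all small vectors.
\<close>
lemma surjective_approximate_preimage:
  fixes A :: "'a::real_normed_vector \<Rightarrow>\<^sub>L 'b::banach"
  assumes "surj (blinfun_apply A)"
  obtains c where "c > 0" "\<And>y. \<exists>x. norm x \<le> c * norm y \<and> norm (A x - y) \<le> norm y / 4"
proof -
  define F where "F k = closure (A ` cball 0 (real k))" for k :: nat
  have "y \<in> (\<Union>k. F k)" for y
  proof -
    obtain x where "y = A x" using assms by blast
    moreover obtain k :: nat where "norm x \<le> real k" using real_arch_simple by blast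
    ultimately have "y \<in> F k"
      unfolding F_def by (intro subsetD[OF closure_subset]) auto
    then show ?thesis by blast
  qed
  then have cover: "(\<Union>k. F k) = UNIV" by blast
  have "closed (F k)" for k by (simp add: F_def)
  from countable_closed_cover_has_interior[OF this cover]
  obtain k y0 r where r: "r > 0" and ball: "cball y0 r \<subseteq> F k" by blast
  define c where "c = (2 * real k + 1) / r"
  have "\<exists>x. norm x \<le> c * norm y \<and> norm (A x - y) \<le> norm y / 4" for y
  proof (cases "y = 0")
    case False
    define z where "z = (r / norm y) *\<^sub>R y"
    have "y0 + z \<in> cball y0 r" "y0 \<in> cball y0 r" using r False by (simp_all add: z_def dist_norm)
    then have mem: "y0 + z \<in> F k" "y0 \<in> F k" using ball by blast+
    have approx: "\<exists>x. norm x \<le> k \<and> dist (A x) w < r / 8" if "w \<in> F k" for w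
    proof -
      have "r / 8 > 0" using r by simp
      then have "\<exists>a \<in> A ` cball 0 (real k). dist a w < r / 8"
        using that unfolding F_def closure_approachable by blast
      then show ?thesis by auto
    qed
    obtain x1 where x1: "norm x1 \<le> k" "dist (A x1) (y0 + z) < r / 8"
      using approx[OF mem(1)] by blast
    obtain x2 where x2: "norm x2 \<le> k" "dist (A x2) y0 < r / 8"
      using approx[OF mem(2)] by blast
    define x where "x = (norm y / r) *\<^sub>R (x1 - x2)"
    have "norm (x1 - x2) \<le> 2 * k + 1"
      using x1(1) x2(1) norm_triangle_ineq4[of x1 x2] by simp
    then have "norm x \<le> c * norm y"
      using r by (simp add: x_def c_def divide_simps mult_left_mono mult.commute)
    moreover have "norm (A x - y) \<le> norm y / 4"
    proof -
      have "norm (A (x1 - x2) - z) \<le> dist (A x1) (y0 + z) + dist (A x2) y0"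
        using norm_triangle_ineq4[of "A x1 - (y0 + z)" "A x2 - y0"]
        by (simp add: dist_norm blinfun.diff_right algebra_simps)
      also have "\<dots> \<le> r / 4" using x1(2) x2(2) by simp
      finally have "norm (A (x1 - x2) - z) \<le> r / 4" .
      moreover have "A x - y = (norm y / r) *\<^sub>R (A (x1 - x2) - z)"
      proof -
        have "A x = (norm y / r) *\<^sub>R A (x1 - x2)" by (simp only: x_def blinfun.scaleR_right)
        moreover have "(norm y / r) *\<^sub>R z = y" using r False by (simp add: z_def)
        ultimately show ?thesis by (simp only: scaleR_diff_right)
      qed
      ultimately show ?thesis
        using r mult_left_mono[of "norm (A (x1 - x2) - z)" "r / 4" "norm y / r"] by simp
    qed
    ultimately show ?thesis by blast
  qed (auto intro!: exI[of _ 0])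
  moreover have "c > 0" using r by (simp add: c_def)
  ultimately show thesis by (rule that[rotated])
qed

text \<open>
  Each correction halves the residual and has length at most \<open>c\<close> times the residual, so the total
  displacement is bounded by the geometric series \<open>c * norm (f x0) * (1 + 1/2 + 1/4 + \<dots>)\<close>. Taking
  \<open>f\<close> affine gives the open mapping theorem, and \<open>f\<close> strictly differentiable the theorem
  of Lyusternik and Graves.
\<close>
lemma zero_by_successive_corrections:
  fixes f :: "'a::banach \<Rightarrow> 'b::real_normed_vector"
  assumes cont: "continuous_on (cball x0 R) f" and c: "c \<ge> 0"
    and step: "\<And>x. x \<in> cball x0 R \<Longrightarrow>
      \<exists>u. norm u \<le> c * norm (f x) \<and> (x + u \<in> cball x0 R \<longrightarrow> norm (f (x + u)) \<le> norm (f x) / 2)"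
    and R: "2 * c * norm (f x0) \<le> R"
  obtains x where "norm (x - x0) \<le> 2 * c * norm (f x0)" "f x = 0"
proof -
  obtain u where u: "norm (u x) \<le> c * norm (f x)"
      "x + u x \<in> cball x0 R \<Longrightarrow> norm (f (x + u x)) \<le> norm (f x) / 2" if "x \<in> cball x0 R" for x
    using step by metis
  define X where "X = rec_nat x0 (\<lambda>_ x. x + u x)"
  have X_Suc: "X (Suc n) = X n + u (X n)" and X_0: "X 0 = x0" for n
    by (simp_all add: X_def)
  define b where "b = c * norm (f x0)"
  have b: "b \<ge> 0" "2 * b \<le> R" using c R by (simp_all add: b_def)
  have inv: "dist x0 (X n) \<le> 2 * b * (1 - (1/2) ^ n) \<and> norm (f (X n)) \<le> norm (f x0) * (1/2) ^ n" for n
  proof (induction n)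
    case (Suc n)
    have in_ball: "X m \<in> cball x0 R" if "dist x0 (X m) \<le> 2 * b * (1 - (1/2) ^ m)" for m
    proof -
      have "2 * b * (1 - (1/2) ^ m) \<le> 2 * b * 1" using b by (intro mult_left_mono) auto
      then show ?thesis using that b by simp
    qed
    have "X n \<in> cball x0 R" using Suc in_ball by blast
    note un = u[OF this]
    have "norm (u (X n)) \<le> c * (norm (f x0) * (1/2) ^ n)"
      using un(1) mult_left_mono[OF conjunct2[OF Suc] c] by linarith
    then have "norm (u (X n)) \<le> b * (1/2) ^ n" by (simp add: b_def mult.assoc)
    moreover have "dist x0 (X (Suc n)) \<le> dist x0 (X n) + norm (u (X n))"
      using dist_triangle[of x0 "X (Suc n)" "X n"] by (simp add: X_Suc dist_norm)
    ultimately have d: "dist x0 (X (Suc n)) \<le> 2 * b * (1 - (1/2) ^ Suc n)"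
      using Suc by (simp add: algebra_simps)
    then have "norm (f (X (Suc n))) \<le> norm (f (X n)) / 2"
      using un(2) in_ball[OF d] by (simp add: X_Suc)
    with d show ?case using Suc by simp
  qed (simp add: X_0)
  have le: "2 * b * (1 - (1/2) ^ n) \<le> 2 * b" for n
    using b mult_left_mono[of "1 - (1/2) ^ n" 1 "2 * b"] by simp
  have in_ball: "X n \<in> cball x0 R" for n
    using inv[of n] le[of n] b by (simp del: mult_le_cancel_left)
  have u_bound: "norm (u (X n)) \<le> b * (1/2) ^ n" for n
  proof -
    have "norm (u (X n)) \<le> c * (norm (f x0) * (1/2) ^ n)"
      using u(1)[OF in_ball[of n]] mult_left_mono[OF conjunct2[OF inv[of n]] c] by linarith
    then show ?thesis by (simp add: b_def mult.assoc)
  qed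
  have "summable (\<lambda>n. b * (1/2 :: real) ^ n)" by (intro summable_mult summable_geometric) simp
  then have "summable (\<lambda>n. u (X n))" by (rule summable_comparison_test'[where N = 0]) (rule u_bound)
  then have "(\<lambda>n. x0 + (\<Sum>i<n. u (X i))) \<longlonglongrightarrow> x0 + (\<Sum>i. u (X i))"
    by (intro tendsto_intros summable_LIMSEQ)
  moreover have "x0 + (\<Sum>i<n. u (X i)) = X n" for n
    by (induction n) (simp_all add: X_0 X_Suc add.assoc [symmetric])
  ultimately have "X \<longlonglongrightarrow> x0 + (\<Sum>i. u (X i))" by simp
  then obtain x where x: "X \<longlonglongrightarrow> x" by blast
  have "dist x0 x \<le> 2 * b"
    using x inv le by (intro LIMSEQ_le_const2[OF tendsto_dist[OF tendsto_const x]]) (meson order_trans)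
  moreover have "f x = 0"
  proof -
    have "x \<in> cball x0 R" using \<open>dist x0 x \<le> 2 * b\<close> b by simp
    then have "(\<lambda>n. f (X n)) \<longlonglongrightarrow> f x"
      using continuous_on_tendsto_compose[OF cont x] in_ball by simp
    moreover have "(\<lambda>n. f (X n)) \<longlonglongrightarrow> 0"
    proof (rule Lim_null_comparison)
      show "\<forall>\<^sub>F n in sequentially. norm (f (X n)) \<le> norm (f x0) * (1/2) ^ n"
        using inv by simp
      show "(\<lambda>n. norm (f x0) * (1/2) ^ n) \<longlonglongrightarrow> 0"
        using tendsto_mult_right_zero[OF LIMSEQ_power_zero[of "1/2 :: real"]] by simp
    qed
    ultimately show ?thesis by (rule LIMSEQ_unique)
  qed
  ultimately show thesis
    using that by (simp add: b_def dist_norm norm_minus_commute mult.assoc)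
qed

theorem open_mapping_bounded_preimage:
  fixes A :: "'a::banach \<Rightarrow>\<^sub>L 'b::banach"
  assumes "surj (blinfun_apply A)"
  obtains c where "c > 0" "\<And>y. \<exists>x. A x = y \<and> norm x \<le> c * norm y"
proof -
  obtain c where c: "c > 0"
    and approx: "\<And>y. \<exists>x. norm x \<le> c * norm y \<and> norm (A x - y) \<le> norm y / 4"
    by (rule surjective_approximate_preimage[OF assms]) blast
  have "\<exists>x. A x = y \<and> norm x \<le> 2 * c * norm y" for y
  proof -
    let ?f = "\<lambda>x. y - A x"
    obtain x where "norm (x - 0) \<le> 2 * c * norm (?f 0)" "?f x = 0"
    proof (rule zero_by_successive_corrections)
      show "continuous_on (cball 0 (2 * c * norm (?f 0))) ?f" by (intro continuous_intros)
      fix x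
      obtain u where u: "norm u \<le> c * norm (?f x)" "norm (A u - ?f x) \<le> norm (?f x) / 4"
        using approx by blast
      have "norm (?f (x + u)) \<le> norm (?f x) / 2"
      proof -
        have "?f (x + u) = - (A u - ?f x)" by (simp add: blinfun.add_right)
        then have "norm (?f (x + u)) = norm (A u - ?f x)" by (simp only: norm_minus_cancel)
        then show ?thesis using u(2) norm_ge_zero[of "?f x"] by linarith
      qed
      then show "\<exists>u. norm u \<le> c * norm (?f x) \<and>
          (x + u \<in> cball 0 (2 * c * norm (?f 0)) \<longrightarrow> norm (?f (x + u)) \<le> norm (?f x) / 2)"
        using u(1) by blast
    qed (use c in simp_all)
    then show ?thesis by (intro exI[of _ x]) simp
  qed
  then show thesis using that[of "2 * c"] c by simp
qed

text \<open>
  The functional factors through \<open>A\<close> algebraically; the open mapping theorem makes the factor bounded.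
\<close>
lemma annihilator_of_kernel_subset_range_adjoint:
  fixes A :: "'a::banach \<Rightarrow>\<^sub>L 'b::banach" and \<phi> :: "'a \<Rightarrow>\<^sub>L real"
  assumes surj: "surj (blinfun_apply A)" and vanish: "\<And>v. A v = 0 \<Longrightarrow> \<phi> v = 0"
  shows "\<phi> \<in> range (adjoint_map A)"
proof -
  obtain c where c: "c > 0" "\<And>y. \<exists>x. A x = y \<and> norm x \<le> c * norm y"
    by (rule open_mapping_bounded_preimage[OF surj]) blast
  have "\<exists>p. \<forall>y. A (p y) = y \<and> norm (p y) \<le> c * norm y" by (rule choice) (use c(2) in blast)
  then obtain p where p: "\<And>y. A (p y) = y" "\<And>y. norm (p y) \<le> c * norm y" by blast
  have cong: "\<phi> x = \<phi> x'" if "A x = A x'" for x x'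
    using vanish[of "x - x'"] that by (simp add: blinfun.diff_right)
  have "bounded_linear (\<lambda>y. \<phi> (p y))"
  proof
    show "\<phi> (p (y + z)) = \<phi> (p y) + \<phi> (p z)" for y z
      using cong[of "p (y + z)" "p y + p z"] by (simp add: p blinfun.add_right)
    show "\<phi> (p (r *\<^sub>R y)) = r *\<^sub>R \<phi> (p y)" for r y
      using cong[of "p (r *\<^sub>R y)" "r *\<^sub>R p y"] by (simp add: p blinfun.scaleR_right)
    have "norm (\<phi> (p y)) \<le> norm y * (norm \<phi> * c)" for y
      using order_trans[OF norm_blinfun[of \<phi> "p y"] mult_left_mono[OF p(2)[of y] norm_ge_zero[of \<phi>]]]
      by (simp add: mult_ac)
    then show "\<exists>K. \<forall>y. norm (\<phi> (p y)) \<le> norm y * K" by blast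
  qed
  note Blinfun_apply = bounded_linear_Blinfun_apply[OF this]
  have "\<phi> = adjoint_map A (Blinfun (\<lambda>y. \<phi> (p y)))"
    by (rule blinfun_eqI) (simp add: adjoint_map_def Blinfun_apply cong[OF p(1)])
  then show ?thesis by blast
qed

lemma strict_derivative_increment_bound:
  fixes h :: "'a::real_normed_vector \<Rightarrow> 'b::real_normed_vector"
  assumes "has_strict_derivative h A xbar" "\<eta> > 0"
  obtains \<rho> where "\<rho> > 0"
    "\<And>x x'. x \<in> cball xbar \<rho> \<Longrightarrow> x' \<in> cball xbar \<rho> \<Longrightarrow> norm (h x - h x' - A (x - x')) \<le> \<eta> * norm (x - x')"
proof -
  have "\<forall>\<^sub>F p in at (xbar, xbar) within {(x, x'). x \<noteq> x'}.
      dist ((\<lambda>(x, x'). (h x - h x' - A (x - x')) /\<^sub>R norm (x - x')) p) 0 < \<eta>"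
    using assms unfolding has_strict_derivative_def by (rule tendstoD)
  then obtain d where d: "d > 0" and
    bound: "\<And>x x'. \<lbrakk>x \<noteq> x'; (x, x') \<noteq> (xbar, xbar); dist (x, x') (xbar, xbar) < d\<rbrakk> \<Longrightarrow>
      norm ((h x - h x' - A (x - x')) /\<^sub>R norm (x - x')) < \<eta>"
    unfolding eventually_at by (auto simp: dist_norm)
  have "norm (h x - h x' - A (x - x')) \<le> \<eta> * norm (x - x')"
    if "x \<in> cball xbar (d / 3)" "x' \<in> cball xbar (d / 3)" for x x'
  proof (cases "x = x'")
    case False
    have "dist (x, x') (xbar, xbar) \<le> dist x xbar + dist x' xbar"
      by (simp add: dist_Pair_Pair sqrt_sum_squares_le_sum)
    also have "\<dots> < d" using that d by (simp add: dist_commute)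
    finally have "norm ((h x - h x' - A (x - x')) /\<^sub>R norm (x - x')) < \<eta>"
      using bound[of x x'] False by blast
    then show ?thesis using False by (simp add: divide_simps mult.commute)
  qed simp
  with d show thesis using that[of "d / 3"] by simp
qed

text \<open>
  Surjectivity of the derivative makes the correction \<open>u\<close> with \<open>A u\<close> close to \<open>- h x\<close> available at
  every point, and strict differentiability makes the effect of this correction on \<open>h\<close> almost that
  of \<open>A\<close>, uniformly near the reference point. Hence the distance to the solution set of \<open>h x = 0\<close>
  is bounded by a multiple of the residual at all points near \<open>xbar\<close>, and not only at \<open>xbar\<close>.
\<close>
theorem lyusternik_graves:
  fixes h :: "'a::banach \<Rightarrow> 'b::banach"
  assumes strict: "has_strict_derivative h A xbar" and surj: "surj (blinfun_apply A)" and zero: "h xbar = 0"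
  obtains c \<rho> where "c > 0" "\<rho> > 0"
    "\<And>x. x \<in> cball xbar \<rho> \<Longrightarrow> \<exists>w. norm w \<le> c * norm (h x) \<and> h (x + w) = 0"
proof -
  obtain c where c: "c > 0"
    and approx: "\<And>y. \<exists>x. norm x \<le> c * norm y \<and> norm (A x - y) \<le> norm y / 4"
    by (rule surjective_approximate_preimage[OF surj]) blast
  have "1 / (4 * c) > 0" using c by simp
  then obtain R where R: "R > 0" and incr: "\<And>x x'. x \<in> cball xbar R \<Longrightarrow> x' \<in> cball xbar R \<Longrightarrow>
      norm (h x - h x' - A (x - x')) \<le> 1 / (4 * c) * norm (x - x')"
    by (rule strict_derivative_increment_bound[OF strict]) blast
  define L where "L = 1 / (4 * c) + norm A"
  have L: "L > 0" using c by (simp add: L_def add_pos_nonneg)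
  have lip: "norm (h x - h x') \<le> L * norm (x - x')" if "x \<in> cball xbar R" "x' \<in> cball xbar R" for x x'
    using incr[OF that] norm_blinfun[of A "x - x'"]
      norm_triangle_ineq[of "h x - h x' - A (x - x')" "A (x - x')"]
    by (simp add: L_def algebra_simps)
  have cont: "continuous_on (cball xbar R) h"
    by (rule lipschitz_on_continuous_on[of L]) (use L lip in \<open>auto simp: lipschitz_on_def dist_norm\<close>)
  \<comment> \<open>The corrections started at \<open>x0\<close> have total length at most \<open>2 * c * norm (h x0)\<close>; the radius
      \<open>\<rho>\<close> is such that they stay in the ball of radius \<open>R\<close>.\<close>
  define \<rho> where "\<rho> = min (R / 2) (R / (4 * c * L))"
  have "\<exists>w. norm w \<le> 2 * c * norm (h x0) \<and> h (x0 + w) = 0" if x0: "x0 \<in> cball xbar \<rho>" for x0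
  proof -
    have sub: "cball x0 (R / 2) \<subseteq> cball xbar R"
    proof
      fix x assume "x \<in> cball x0 (R / 2)"
      moreover have "dist xbar x0 \<le> R / 2" using x0 by (simp add: \<rho>_def)
      ultimately show "x \<in> cball xbar R" using dist_triangle[of xbar x x0] by simp
    qed
    have "norm (h x0) \<le> L * norm (x0 - xbar)"
      using lip[of x0 xbar] x0 R zero by (simp add: \<rho>_def)
    also have "\<dots> \<le> L * (R / (4 * c * L))"
      using x0 L by (intro mult_left_mono) (auto simp: \<rho>_def dist_norm norm_minus_commute)
    finally have small: "2 * c * norm (h x0) \<le> R / 2" using c L by (simp add: field_simps)
    obtain x where "norm (x - x0) \<le> 2 * c * norm (h x0)" "h x = 0"
    proof (rule zero_by_successive_corrections[where ?x0.0 = x0 and c = c and R = "R / 2" and f = h])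
      show "continuous_on (cball x0 (R / 2)) h" using cont sub by (rule continuous_on_subset)
      fix x assume x: "x \<in> cball x0 (R / 2)"
      obtain u where u: "norm u \<le> c * norm (h x)" "norm (A u + h x) \<le> norm (h x) / 4"
        using approx[of "- h x"] by auto
      have "norm (h (x + u)) \<le> norm (h x) / 2" if "x + u \<in> cball x0 (R / 2)"
      proof -
        have "norm (h (x + u) - h x - A u) \<le> 1 / (4 * c) * norm u"
          using incr[of "x + u" x] subsetD[OF sub that] subsetD[OF sub x] by (simp del: mem_cball)
        also have "\<dots> \<le> norm (h x) / 4" using u(1) c by (simp add: field_simps)
        finally show ?thesis
          using u(2) norm_triangle_ineq[of "h (x + u) - h x - A u" "A u + h x"] by simp
      qed
      then show "\<exists>u. norm u \<le> c * norm (h x) \<and>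
          (x + u \<in> cball x0 (R / 2) \<longrightarrow> norm (h (x + u)) \<le> norm (h x) / 2)"
        using u(1) by blast
    qed (use c small in simp_all)
    then show ?thesis by (intro exI[of _ "x - x0"]) simp
  qed
  moreover have "\<rho> > 0" using R c L by (simp add: \<rho>_def)
  ultimately show thesis using that[of "2 * c" \<rho>] c by simp
qed

section \<open>Separation of convex cones\<close>

text \<open>
  An algebraic form of the Hahn-Banach theorem. By Zorn's lemma there is a convex cone \<open>M\<close> containing
  \<open>P\<close> that is maximal among those not containing \<open>- e\<close>. Maximality forces \<open>M \<union> - M\<close> to be the
  whole space, and then \<open>l v\<close> is the largest \<open>r\<close> for which \<open>v - r e\<close> belongs to \<open>M\<close>, up to closure.
\<close>
theorem order_unit_separation:
  fixes P :: "'a::real_vector set"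
  assumes P: "convex_cone P" and unit: "\<And>v. \<exists>s>0. e + s *\<^sub>R v \<in> P" and proper: "- e \<notin> P"
  obtains l :: "'a \<Rightarrow> real" where "linear l" "l e = 1" "\<And>p. p \<in> P \<Longrightarrow> l p \<ge> 0"
proof -
  define \<C> where "\<C> = {Q. convex_cone Q \<and> P \<subseteq> Q \<and> - e \<notin> Q}"
  have "\<exists>M\<in>\<C>. \<forall>Q\<in>\<C>. M \<subseteq> Q \<longrightarrow> Q = M"
  proof (rule subset_Zorn_nonempty)
    show "\<C> \<noteq> {}" using P proper by (auto simp: \<C>_def)
    fix \<K> assume ne: "\<K> \<noteq> {}" and chain: "subset.chain \<C> \<K>"
    have sub: "\<K> \<subseteq> \<C>" and tot: "\<And>Q R. Q \<in> \<K> \<Longrightarrow> R \<in> \<K> \<Longrightarrow> Q \<subseteq> R \<or> R \<subseteq> Q"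
      using chain by (auto simp: subset_chain_def)
    have cone: "convex_cone Q" if "Q \<in> \<K>" for Q using sub that by (auto simp: \<C>_def)
    have "convex_cone (\<Union>\<K>)"
      unfolding convex_cone_iff
    proof (intro conjI ballI allI impI)
      show "0 \<in> \<Union>\<K>" using ne cone convex_cone_contains_0 by blast
      show "x + y \<in> \<Union>\<K>" if "x \<in> \<Union>\<K>" "y \<in> \<Union>\<K>" for x y
      proof -
        obtain Q R where "x \<in> Q" "y \<in> R" "Q \<in> \<K>" "R \<in> \<K>" using \<open>x \<in> \<Union>\<K>\<close> \<open>y \<in> \<Union>\<K>\<close> by blast
        with tot[of Q R] obtain S where "S \<in> \<K>" "x \<in> S" "y \<in> S" by blast
        then show ?thesis using convex_cone_add[OF cone] by blast
      qed
      show "c *\<^sub>R x \<in> \<Union>\<K>" if "x \<in> \<Union>\<K>" "0 \<le> c" for x c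
        using that convex_cone_scaleR[OF cone] by blast
    qed
    moreover have "P \<subseteq> \<Union>\<K>" "- e \<notin> \<Union>\<K>" using ne sub by (auto simp: \<C>_def)
    ultimately show "\<Union>\<K> \<in> \<C>" by (simp add: \<C>_def)
  qed
  then obtain M where "M \<in> \<C>" and max: "\<And>Q. Q \<in> \<C> \<Longrightarrow> M \<subseteq> Q \<Longrightarrow> Q = M" by blast
  then have M: "convex_cone M" "P \<subseteq> M" "- e \<notin> M" by (auto simp: \<C>_def)
  note add = convex_cone_add[OF M(1)] and scale = convex_cone_scaleR[OF M(1)]
  have e: "e \<in> M" using unit[of 0] M(2) by auto
  \<comment> \<open>Otherwise the cone generated by \<open>M\<close> and \<open>v\<close> contains \<open>- e\<close>, say \<open>- e = p + a v\<close>;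
      here \<open>a > 0\<close>, so \<open>- v\<close> is a positive multiple of \<open>e + p\<close>.\<close>
  have total: "v \<in> M \<or> - v \<in> M" for v
  proof (rule ccontr)
    assume neg: "\<not> ?thesis"
    define Q where "Q = {p + a *\<^sub>R v | p a. p \<in> M \<and> a \<ge> 0}"
    have "convex_cone Q"
      unfolding convex_cone_iff
    proof (intro conjI ballI allI impI)
      show "0 \<in> Q" unfolding Q_def using convex_cone_contains_0[OF M(1)] by force
      show "x + y \<in> Q" if "x \<in> Q" "y \<in> Q" for x y
      proof -
        from that obtain p a q b where "x = p + a *\<^sub>R v" "p \<in> M" "a \<ge> 0"
          "y = q + b *\<^sub>R v" "q \<in> M" "b \<ge> 0" unfolding Q_def by blast
        then have "x + y = (p + q) + (a + b) *\<^sub>R v" "p + q \<in> M" "a + b \<ge> 0"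
          by (simp_all add: algebra_simps add)
        then show ?thesis unfolding Q_def by blast
      qed
      show "c *\<^sub>R x \<in> Q" if "x \<in> Q" "0 \<le> c" for x c
      proof -
        from that obtain p a where "x = p + a *\<^sub>R v" "p \<in> M" "a \<ge> 0" unfolding Q_def by blast
        then have "c *\<^sub>R x = c *\<^sub>R p + (c * a) *\<^sub>R v" "c *\<^sub>R p \<in> M" "c * a \<ge> 0"
          using that by (simp_all add: scaleR_add_right scale)
        then show ?thesis unfolding Q_def by blast
      qed
    qed
    moreover have "M \<subseteq> Q"
    proof
      fix p assume "p \<in> M"
      then have "p = p + 0 *\<^sub>R v \<and> p \<in> M \<and> (0::real) \<le> 0" by simp
      then show "p \<in> Q" unfolding Q_def by blast
    qed
    moreover have "v \<in> Q"
    proof -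
      have "v = 0 + 1 *\<^sub>R v \<and> 0 \<in> M \<and> (0::real) \<le> 1" using convex_cone_contains_0[OF M(1)] by simp
      then show ?thesis unfolding Q_def by blast
    qed
    ultimately have "- e \<in> Q" using max[of Q] neg M(2) by (auto simp: \<C>_def)
    then obtain p a where pa: "- e = p + a *\<^sub>R v" "p \<in> M" "a \<ge> 0" unfolding Q_def by blast
    with M(3) have "a > 0" by (cases "a = 0") auto
    have "a *\<^sub>R v = - (e + p)" using pa(1) by (simp add: eq_neg_iff_add_eq_0 algebra_simps)
    then have "(1 / a) *\<^sub>R (e + p) = - v"
      using \<open>a > 0\<close> by (metis less_numeral_extra(3) minus_equation_iff nonzero_divide_eq_eq
          scaleR_minus_right scaleR_one scaleR_scaleR)
    moreover have "(1 / a) *\<^sub>R (e + p) \<in> M" using \<open>a > 0\<close> e pa(2) by (intro scale add) auto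
    ultimately show False using neg by simp
  qed
  define L where "L v = {r. v - r *\<^sub>R e \<in> M}" for v
  have nonneg_unit: "r \<ge> 0" if "r *\<^sub>R e \<in> M" for r
  proof (rule ccontr)
    assume "\<not> r \<ge> 0"
    then have "(1 / - r) *\<^sub>R (r *\<^sub>R e) \<in> M" using scale[of "1 / - r" "r *\<^sub>R e"] that by simp
    moreover have "(1 / - r) *\<^sub>R (r *\<^sub>R e) = - e" using \<open>\<not> r \<ge> 0\<close> by simp
    ultimately show False using M(3) by simp
  qed
  have L_add: "r + s \<in> L (v + w)" if "r \<in> L v" "s \<in> L w" for r s v w
    using add[of "v - r *\<^sub>R e" "w - s *\<^sub>R e"] that by (simp add: L_def algebra_simps)
  have L_ne: "L v \<noteq> {}" for v
  proof -
    obtain s where "s > 0" "e + s *\<^sub>R v \<in> M" using unit[of v] M(2) by blast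
    then have "(1 / s) *\<^sub>R (e + s *\<^sub>R v) \<in> M" by (intro scale) auto
    then have "v - (- (1 / s)) *\<^sub>R e \<in> M" using \<open>s > 0\<close> by (simp add: scaleR_add_right add.commute)
    then show ?thesis unfolding L_def by blast
  qed
  have L_opp: "r + s \<le> 0" if "r \<in> L v" "s \<in> L (- v)" for r s v
  proof -
    have "(- (r + s)) *\<^sub>R e \<in> M"
      using L_add[OF that] by (simp add: L_def del: minus_add_distrib)
    from nonneg_unit[OF this] show ?thesis by simp
  qed
  have L_bdd: "bdd_above (L v)" for v
  proof -
    obtain s where "s \<in> L (- v)" using L_ne[of "- v"] by blast
    then have "r \<le> - s" if "r \<in> L v" for r using L_opp[OF that] by force
    then show ?thesis by (rule bdd_aboveI)
  qed
  define l where "l v = Sup (L v)" for v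
  have l_ge: "r \<le> l v" if "r \<in> L v" for r v
    unfolding l_def using that L_bdd by (rule cSup_upper)
  \<comment> \<open>Superadditivity is additivity of \<open>M\<close>; the converse inequality follows from \<open>l (- v) = - l v\<close>,
      which is where totality enters.\<close>
  have l_super: "l v + l w \<le> l (v + w)" for v w
  proof -
    have "r + l w \<le> l (v + w)" if r: "r \<in> L v" for r
    proof -
      have "s \<le> l (v + w) - r" if "s \<in> L w" for s using l_ge[OF L_add[OF r that]] by simp
      then have "l w \<le> l (v + w) - r" unfolding l_def[of w] by (intro cSup_least L_ne)
      then show ?thesis by simp
    qed
    then have "r \<le> l (v + w) - l w" if "r \<in> L v" for r using that by (simp add: le_diff_eq)
    then have "l v \<le> l (v + w) - l w" unfolding l_def[of v] by (intro cSup_least L_ne)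
    then show ?thesis by simp
  qed
  have l_0: "l 0 = 0"
  proof (rule antisym)
    show "l 0 \<le> 0" unfolding l_def by (intro cSup_least L_ne) (use L_opp[of _ 0] in fastforce)
    show "0 \<le> l 0" by (rule l_ge) (simp add: L_def convex_cone_contains_0[OF M(1)])
  qed
  have l_minus: "l (- v) = - l v" for v
  proof (rule antisym)
    show "l (- v) \<le> - l v" using l_super[of v "- v"] l_0 by simp
    show "- l v \<le> l (- v)"
    proof (rule field_le_epsilon)
      fix d :: real assume "d > 0"
      then have "l v + d \<notin> L v" using l_ge[of "l v + d" v] by auto
      then have "- (v - (l v + d) *\<^sub>R e) \<in> M"
        using total[of "v - (l v + d) *\<^sub>R e"] by (auto simp only: L_def mem_Collect_eq)
      moreover have "- (v - c *\<^sub>R e) = - v - (- c) *\<^sub>R e" for c by simp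
      ultimately have "- (l v + d) \<in> L (- v)" by (simp only: L_def mem_Collect_eq)
      then show "- l v \<le> l (- v) + d" using l_ge by fastforce
    qed
  qed
  have l_add: "l (v + w) = l v + l w" for v w
    using l_super[of v w] l_super[of "v + w" "- w"] by (simp add: l_minus)
  have L_scale: "c * r \<in> L (c *\<^sub>R v)" if "r \<in> L v" "c \<ge> 0" for c r v
    using scale[of c "v - r *\<^sub>R e"] that by (simp add: L_def scaleR_diff_right)
  have l_scale_le: "c * l v \<le> l (c *\<^sub>R v)" if "c > 0" for c v
  proof -
    have "r \<le> l (c *\<^sub>R v) / c" if "r \<in> L v" for r
      using l_ge[OF L_scale[OF that]] \<open>c > 0\<close> by (simp add: field_simps)
    then have "l v \<le> l (c *\<^sub>R v) / c" unfolding l_def[of v] by (intro cSup_least L_ne)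
    then show ?thesis using that by (simp add: field_simps)
  qed
  have l_scale_pos: "l (c *\<^sub>R v) = c * l v" if "c > 0" for c v
    using l_scale_le[OF that, of v] l_scale_le[of "1 / c" "c *\<^sub>R v"] that by (simp add: field_simps)
  have l_scale: "l (c *\<^sub>R v) = c * l v" for c v
  proof (cases "c > 0")
    case False
    show ?thesis
    proof (cases "c = 0")
      case False
      then have "l ((- c) *\<^sub>R v) = (- c) * l v" using \<open>\<not> c > 0\<close> by (intro l_scale_pos) simp
      then show ?thesis by (simp add: l_minus)
    qed (simp add: l_0)
  qed (rule l_scale_pos)
  have "linear l" by (rule linearI) (simp_all add: l_add l_scale)
  moreover have nonneg: "l p \<ge> 0" if "p \<in> P" for p
    by (rule l_ge) (use that M(2) in \<open>auto simp: L_def\<close>)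
  moreover have "l e = 1"
  proof (rule antisym)
    show "1 \<le> l e" by (rule l_ge) (simp add: L_def convex_cone_contains_0[OF M(1)])
    have "r \<le> 1" if "r \<in> L e" for r
      using nonneg_unit[of "1 - r"] that by (simp add: L_def scaleR_diff_left)
    then show "l e \<le> 1" unfolding l_def by (intro cSup_least L_ne)
  qed
  ultimately show thesis using that by blast
qed

text \<open>
  An extension theorem of M. Riesz and Krein. The extension is a multiple of a functional that is
  nonnegative on the cone generated by \<open>- D\<close> and the half-space \<open>\<phi> v \<ge> 0\<close> of \<open>V\<close>, for which \<open>- xt\<close> is
  an order unit. It is continuous because it is bounded above on a ball.
\<close>
theorem nonpositive_functional_extension:
  fixes \<phi> :: "'a::real_normed_vector \<Rightarrow>\<^sub>L real"
  assumes V: "subspace V" and D: "convex_cone D" and xt: "xt \<in> V"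
    and r: "r > 0" and ball: "cball xt r \<subseteq> D"
    and nonpos: "\<And>d. d \<in> D \<Longrightarrow> d \<in> V \<Longrightarrow> \<phi> d \<le> 0"
  obtains \<psi> :: "'a \<Rightarrow>\<^sub>L real" where "\<And>d. d \<in> D \<Longrightarrow> \<psi> d \<le> 0" "\<And>v. v \<in> V \<Longrightarrow> \<psi> v = \<phi> v"
proof -
  have unit: "\<exists>s>0. xt + s *\<^sub>R v \<in> D \<and> xt - s *\<^sub>R v \<in> D" for v
  proof -
    define s where "s = r / (norm v + 1)"
    have "s > 0" using r by (simp add: s_def add_nonneg_pos)
    moreover have "s * norm v \<le> r" 
      using r by (simp add: s_def divide_simps add_nonneg_pos)
    then have "xt + s *\<^sub>R v \<in> cball xt r" "xt - s *\<^sub>R v \<in> cball xt r"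
      using \<open>s > 0\<close> by (simp_all add: dist_norm)
    ultimately show ?thesis using ball by blast
  qed
  have "xt \<in> D" using ball r by auto
  then have "\<phi> xt \<le> 0" using nonpos xt by blast
  then consider "\<phi> xt = 0" | "\<phi> xt < 0" by linarith
  then show thesis
  proof cases
    case 1
    \<comment> \<open>On \<open>V\<close> the functional attains its maximum over \<open>D\<close> at an interior point, so it is zero.\<close>
    have "\<phi> v = 0" if "v \<in> V" for v
    proof -
      obtain s where s: "s > 0" "xt + s *\<^sub>R v \<in> D" "xt - s *\<^sub>R v \<in> D" using unit by blast
      have "xt + s *\<^sub>R v \<in> V" "xt - s *\<^sub>R v \<in> V"
        using V xt that by (simp_all add: subspace_add subspace_diff subspace_scale)
      with s nonpos have "\<phi> (xt + s *\<^sub>R v) \<le> 0" "\<phi> (xt - s *\<^sub>R v) \<le> 0" by blast+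
      then show ?thesis
        using 1 s(1) by (simp add: blinfun.add_right blinfun.diff_right blinfun.scaleR_right
            mult_le_0_iff zero_le_mult_iff)
    qed
    then show ?thesis using that[of 0] by simp
  next
    case 2
    \<comment> \<open>A functional \<open>l\<close> that is nonnegative on \<open>P\<close> is nonpositive on \<open>D\<close>, and on \<open>V\<close> it is nonnegative
        wherever \<open>\<phi>\<close> is, hence a multiple of \<open>\<phi>\<close> there.\<close>
    define P where "P = {v - d | v d. v \<in> V \<and> \<phi> v \<ge> 0 \<and> d \<in> D}"
    have PI: "v - d \<in> P" if "v \<in> V" "\<phi> v \<ge> 0" "d \<in> D" for v d
      using that unfolding P_def by blast
    have "convex_cone P"
      unfolding convex_cone_iff
    proof (intro conjI ballI allI impI)
      show "0 \<in> P" using PI[of 0 0] subspace_0[OF V] convex_cone_contains_0[OF D] by simp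
      show "x + y \<in> P" if "x \<in> P" "y \<in> P" for x y
      proof -
        from that obtain v d w c where *: "x = v - d" "v \<in> V" "\<phi> v \<ge> 0" "d \<in> D"
          "y = w - c" "w \<in> V" "\<phi> w \<ge> 0" "c \<in> D" unfolding P_def by blast
        then have "(v + w) - (d + c) \<in> P"
          using V D by (intro PI) (auto simp: subspace_add convex_cone_add blinfun.add_right)
        then show ?thesis by (simp add: * algebra_simps)
      qed
      show "a *\<^sub>R x \<in> P" if "x \<in> P" "0 \<le> a" for x a
      proof -
        from that obtain v d where *: "x = v - d" "v \<in> V" "\<phi> v \<ge> 0" "d \<in> D" unfolding P_def by blast
        then have "a *\<^sub>R v - a *\<^sub>R d \<in> P"
          using V D that by (intro PI) (auto simp: subspace_scale convex_cone_scaleR blinfun.scaleR_right)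
        then show ?thesis by (simp add: * algebra_simps)
      qed
    qed
    moreover have "\<exists>s>0. - xt + s *\<^sub>R v \<in> P" for v
    proof -
      obtain s where s: "s > 0" "xt - s *\<^sub>R v \<in> D" using unit by blast
      then have "0 - (xt - s *\<^sub>R v) \<in> P" using subspace_0[OF V] by (intro PI) auto
      then show ?thesis using s by auto
    qed
    moreover have "- (- xt) \<notin> P"
    proof
      assume "- (- xt) \<in> P"
      then obtain v d where *: "xt = v - d" "v \<in> V" "\<phi> v \<ge> 0" "d \<in> D" unfolding P_def by auto
      then have "d = v - xt" by simp
      then have "\<phi> (v - xt) \<le> 0" using nonpos[OF *(4)] subspace_diff[OF V *(2) xt] by simp
      then show False using * 2 by (simp add: blinfun.diff_right)
    qed
    ultimately obtain l :: "'a \<Rightarrow> real"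
      where lin: "linear l" and l_unit: "l (- xt) = 1" and l_pos: "\<And>p. p \<in> P \<Longrightarrow> l p \<ge> 0"
      by (rule order_unit_separation) blast
    have l_D: "l d \<le> 0" if "d \<in> D" for d
      using l_pos[OF PI[OF subspace_0[OF V] _ that]] by (simp add: linear_neg[OF lin])
    have l_V: "(- \<phi> xt) * l v = \<phi> v" if "v \<in> V" for v
    proof -
      define w where "w = v - (\<phi> v / \<phi> xt) *\<^sub>R xt"
      have "w \<in> V" using V xt that by (simp add: w_def subspace_diff subspace_scale)
      moreover have "\<phi> w = 0" using 2 by (simp add: w_def blinfun.diff_right blinfun.scaleR_right)
      moreover have "0 \<in> D" using D by (rule convex_cone_contains_0)
      ultimately have "w \<in> P" "- w \<in> P"
        using PI[of w 0] PI[of "- w" 0] V by (simp_all add: subspace_neg blinfun.minus_right)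
      then have "l w = 0" using l_pos[of w] l_pos[of "- w"] by (simp add: linear_neg[OF lin])
      then have "l v = (\<phi> v / \<phi> xt) * l xt"
        by (simp add: w_def linear_diff[OF lin] linear_scale[OF lin])
      then show ?thesis using 2 l_unit by (simp add: linear_neg[OF lin])
    qed
    have "bounded_linear l"
    proof (rule bounded_linear_intro)
      show "l (x + y) = l x + l y" "l (a *\<^sub>R x) = a *\<^sub>R l x" for x y a
        using lin by (simp_all add: linear_add linear_scale)
      fix v
      have upper: "l w \<le> norm w / r" for w
      proof (cases "w = 0")
        case False
        have "xt + (r / norm w) *\<^sub>R w \<in> cball xt r" using r False by (simp add: dist_norm)
        then have "l (xt + (r / norm w) *\<^sub>R w) \<le> 0" using ball l_D by blast
        then have "(r / norm w) * l w \<le> 1"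
          using l_unit by (simp add: linear_add[OF lin] linear_scale[OF lin] linear_neg[OF lin])
        then show ?thesis using r False by (simp add: field_simps)
      qed (simp add: linear_0[OF lin])
      show "norm (l v) \<le> norm v * (1 / r)"
        using upper[of v] upper[of "- v"] by (simp add: linear_neg[OF lin] abs_le_iff)
    qed
    then have apply_l: "blinfun_apply (Blinfun l) = l" by (rule bounded_linear_Blinfun_apply)
    show ?thesis
    proof (rule that[of "(- \<phi> xt) *\<^sub>R Blinfun l"])
      show "((- \<phi> xt) *\<^sub>R Blinfun l) d \<le> 0" if "d \<in> D" for d
        using l_D[OF that] 2 by (simp add: apply_l blinfun.scaleR_left blinfun.minus_left mult_nonpos_nonpos)
      show "((- \<phi> xt) *\<^sub>R Blinfun l) v = \<phi> v" if "v \<in> V" for v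
        using l_V[OF that] by (simp add: apply_l blinfun.scaleR_left blinfun.minus_left)
    qed
  qed
qed

section \<open>Weak* closures of generated cones\<close>

text \<open>
  In the induction step, either \<open>L j\<close> vanishes on the common kernel of the others and is redundant, or
  some \<open>v0\<close> in that kernel has \<open>L j v0 \<noteq> 0\<close>, and subtracting the multiple of \<open>L j\<close> that agrees with
  \<open>l\<close> at \<open>v0\<close> reduces to the smaller family.
\<close>
lemma functional_in_span_of_common_kernel:
  fixes l :: "'v::real_vector \<Rightarrow> real" and L :: "'i \<Rightarrow> 'v \<Rightarrow> real"
  assumes "finite F" "linear l" "\<And>i. i \<in> F \<Longrightarrow> linear (L i)"
    and "\<And>v. (\<And>i. i \<in> F \<Longrightarrow> L i v = 0) \<Longrightarrow> l v = 0"
  shows "\<exists>a. \<forall>v. l v = (\<Sum>i\<in>F. a i * L i v)"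
  using assms
proof (induction F arbitrary: l rule: finite_induct)
  case (insert j F)
  show ?case
  proof (cases "\<exists>v0. (\<forall>i\<in>F. L i v0 = 0) \<and> L j v0 \<noteq> 0")
    case False
    then have "\<exists>a. \<forall>v. l v = (\<Sum>i\<in>F. a i * L i v)"
      using insert.prems by (intro insert.IH) auto
    then obtain a where a: "\<And>v. l v = (\<Sum>i\<in>F. a i * L i v)" by blast
    have "(\<Sum>i\<in>insert j F. (a(j := 0)) i * L i v) = (\<Sum>i\<in>F. a i * L i v)" for v
      using insert.hyps by (auto intro!: sum.cong)
    then show ?thesis using a by (intro exI[of _ "a(j := 0)"]) simp
  next
    case True
    then obtain v0 where v0: "\<And>i. i \<in> F \<Longrightarrow> L i v0 = 0" "L j v0 \<noteq> 0" by blast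
    define c where "c = l v0 / L j v0"
    have lin_j: "linear (L j)" using insert.prems(2) by simp
    have "\<exists>a. \<forall>v. l v - c * L j v = (\<Sum>i\<in>F. a i * L i v)"
    proof (rule insert.IH)
      show "linear (\<lambda>v. l v - c * L j v)"
        by (rule linearI) (simp_all add: linear_add[OF insert.prems(1)] linear_scale[OF insert.prems(1)]
            linear_add[OF lin_j] linear_scale[OF lin_j] algebra_simps)
      show "linear (L i)" if "i \<in> F" for i using insert.prems(2) that by simp
      fix v assume v: "\<And>i. i \<in> F \<Longrightarrow> L i v = 0"
      define w where "w = v - (L j v / L j v0) *\<^sub>R v0"
      have lin_w: "k w = k v - (L j v / L j v0) * k v0" if "linear k" for k :: "'v \<Rightarrow> real"
        by (simp add: w_def linear_diff[OF that] linear_scale[OF that])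
      have "L i w = 0" if "i \<in> insert j F" for i
        using that lin_w[OF insert.prems(2)[OF that]] v v0 by auto
      then have "l w = 0" by (rule insert.prems(3))
      then show "l v - c * L j v = 0"
        using lin_w[OF insert.prems(1)] by (simp add: c_def)
    qed
    then obtain a where a: "\<And>v. l v - c * L j v = (\<Sum>i\<in>F. a i * L i v)" by blast
    have "(\<Sum>i\<in>insert j F. (a(j := c)) i * L i v) = c * L j v + (\<Sum>i\<in>F. a i * L i v)" for v
      using insert.hyps by (auto intro!: sum.cong)
    then show ?thesis using a by (intro exI[of _ "a(j := c)"]) (simp add: diff_eq_eq add.commute)
  qed
qed auto

lemma weak_star_open_contains_finite_neighbourhood:
  fixes \<phi> :: "'a::real_normed_vector \<Rightarrow>\<^sub>L real"
  assumes "openin weak_star U" "\<phi> \<in> U"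
  obtains F e where "finite F" "e > 0" "\<And>\<psi>. (\<And>d. d \<in> F \<Longrightarrow> \<bar>blinfun_apply \<psi> d - \<phi> d\<bar> < e) \<Longrightarrow> \<psi> \<in> U"
proof -
  obtain W where W: "openin euclidean W" "U = blinfun_apply -` W \<inter> UNIV"
    using assms(1) unfolding strong_operator_topology_def openin_pullback_topology by blast
  then have "openin (product_topology (\<lambda>i. euclidean) UNIV) W"
    by (simp add: euclidean_product_topology)
  moreover have "blinfun_apply \<phi> \<in> W" using W assms(2) by auto
  ultimately obtain X where X: "blinfun_apply \<phi> \<in> (\<Pi>\<^sub>E i\<in>UNIV. X i)" "\<And>i. open (X i)"
      "finite {i. X i \<noteq> UNIV}" "(\<Pi>\<^sub>E i\<in>UNIV. X i) \<subseteq> W"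
    using product_topology_open_contains_basis[of "\<lambda>i. euclidean" UNIV W "blinfun_apply \<phi>"]
    by auto
  define F where "F = {i. X i \<noteq> UNIV}"
  have "\<exists>e>0. \<forall>y. \<bar>y - \<phi> i\<bar> < e \<longrightarrow> y \<in> X i" for i
  proof -
    have "\<phi> i \<in> X i" using X(1) by auto
    then show ?thesis using X(2)[of i] unfolding open_dist by (auto simp: dist_real_def)
  qed
  then obtain \<epsilon> where \<epsilon>: "\<And>i. \<epsilon> i > 0" "\<And>i y. \<bar>y - \<phi> i\<bar> < \<epsilon> i \<Longrightarrow> y \<in> X i" by metis
  define e where "e = Min (insert 1 (\<epsilon> ` F))"
  have fin: "finite F" using X(3) by (simp add: F_def)
  have "e > 0" using fin \<epsilon>(1) by (simp add: e_def)
  moreover have "\<psi> \<in> U" if *: "\<And>d. d \<in> F \<Longrightarrow> \<bar>blinfun_apply \<psi> d - \<phi> d\<bar> < e" for \<psi>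
  proof -
    have "\<psi> i \<in> X i" for i
    proof (cases "i \<in> F")
      case True
      then have "e \<le> \<epsilon> i" using fin by (simp add: e_def)
      then show ?thesis using *[OF True] by (intro \<epsilon>(2)) simp
    qed (simp add: F_def)
    then have "blinfun_apply \<psi> \<in> W" using X(4) by (auto simp: PiE_def)
    then show ?thesis using W by simp
  qed
  ultimately show thesis using that fin by blast
qed

lemma closedin_weak_star_halfspace:
  "closedin weak_star {\<phi> :: 'a::real_normed_vector \<Rightarrow>\<^sub>L real. \<phi> d \<le> 0}"
proof -
  have "closedin weak_star {\<phi> :: 'a \<Rightarrow>\<^sub>L real. \<phi> \<in> topspace weak_star \<and> \<phi> d \<in> {..0}}"
    by (rule closedin_continuous_map_preimage[OF strong_operator_topology_continuous_evaluation])
      (simp add: closed_closedin [symmetric])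
  then show ?thesis by (simp add: strong_operator_topology_topspace)
qed

text \<open>
  The bipolar theorem. If \<open>\<phi>\<close> is not in the closure, then some weak* neighbourhood of \<open>\<phi>\<close>,
  described by finitely many points of the space, misses the cone. A functional on the dual that
  separates the cone from this neighbourhood vanishes where these points do, hence it is the evaluation
  at a linear combination of them.
\<close>
theorem weak_star_closure_generated_cone:
  fixes S :: "('a::real_normed_vector \<Rightarrow>\<^sub>L real) set"
  shows "weak_star closure_of generated_cone S = {\<phi> :: 'a \<Rightarrow>\<^sub>L real. \<forall>d. (\<forall>s\<in>S. s d \<le> 0) \<longrightarrow> \<phi> d \<le> 0}"
    (is "?cl = ?polar")
proof
  have "closedin weak_star (\<Inter>d\<in>{d. \<forall>s\<in>S. s d \<le> 0}. {\<phi> :: 'a \<Rightarrow>\<^sub>L real. \<phi> d \<le> 0})"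
    by (intro closedin_Inter) (auto intro: closedin_weak_star_halfspace intro!: exI[of _ 0])
  moreover have "(\<Inter>d\<in>{d. \<forall>s\<in>S. s d \<le> 0}. {\<phi> :: 'a \<Rightarrow>\<^sub>L real. \<phi> d \<le> 0}) = ?polar" by auto
  moreover have "generated_cone S \<subseteq> ?polar"
    unfolding generated_cone_def
  proof (rule hull_minimal)
    show "convex_cone ?polar"
      unfolding convex_cone_iff
      by (auto simp: blinfun.add_left blinfun.scaleR_left mult_nonneg_nonpos intro: add_nonpos_nonpos)
  qed auto
  ultimately show "?cl \<subseteq> ?polar" by (intro closure_of_minimal) auto
next
  show "?polar \<subseteq> ?cl"
  proof (rule ccontr)
    assume "\<not> ?thesis"
    then obtain \<phi> where \<phi>: "\<phi> \<in> ?polar" "\<phi> \<notin> ?cl" by blast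
    let ?C = "generated_cone S"
    have C: "convex_cone ?C" and S: "S \<subseteq> ?C"
      by (auto simp: generated_cone_def convex_cone_convex_cone_hull intro: hull_inc)
    from \<phi>(2) obtain U where U: "openin weak_star U" "\<phi> \<in> U" "U \<inter> ?C = {}"
      by (auto simp: in_closure_of strong_operator_topology_topspace)
    then obtain F e where F: "finite F" and e: "e > 0"
      and nbh: "\<And>\<psi>. (\<And>d. d \<in> F \<Longrightarrow> \<bar>blinfun_apply \<psi> d - \<phi> d\<bar> < e) \<Longrightarrow> \<psi> \<in> U"
      using weak_star_open_contains_finite_neighbourhood by metis
    \<comment> \<open>\<open>P\<close> is the cone generated by \<open>?C\<close> and a neighbourhood of \<open>- \<phi>\<close>. So \<open>- \<phi>\<close> is an order unit,
        and \<open>\<phi>\<close> is not in \<open>P\<close> because the neighbourhood \<open>U\<close> of \<open>\<phi>\<close> misses \<open>?C\<close>.\<close>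
    define P where "P = {c + s *\<^sub>R (u - \<phi>) | c s u. c \<in> ?C \<and> s \<ge> 0 \<and> (\<forall>d\<in>F. \<bar>blinfun_apply u d\<bar> < e)}"
    have PI: "c + s *\<^sub>R (u - \<phi>) \<in> P" if "c \<in> ?C" "s \<ge> 0" "\<And>d. d \<in> F \<Longrightarrow> \<bar>blinfun_apply u d\<bar> < e" for c s u
      using that unfolding P_def by blast
    have zero: "0 \<in> ?C" using C by (rule convex_cone_contains_0)
    have "convex_cone P"
      unfolding convex_cone_iff
    proof (intro conjI ballI allI impI)
      show "0 \<in> P" using PI[OF zero, of 0 0] e by simp
      show "a *\<^sub>R x \<in> P" if x: "x \<in> P" and a: "0 \<le> a" for x a
      proof -
        obtain c s u where *: "x = c + s *\<^sub>R (u - \<phi>)" "c \<in> ?C" "s \<ge> 0" "\<And>d. d \<in> F \<Longrightarrow> \<bar>blinfun_apply u d\<bar> < e"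
          using x unfolding P_def by blast
        then have "a *\<^sub>R c + (a * s) *\<^sub>R (u - \<phi>) \<in> P"
          using a C by (intro PI) (auto simp: convex_cone_scaleR)
        then show ?thesis by (simp add: * scaleR_add_right)
      qed
      show "x + y \<in> P" if xy: "x \<in> P" "y \<in> P" for x y
      proof -
        obtain c s u where x: "x = c + s *\<^sub>R (u - \<phi>)" "c \<in> ?C" "s \<ge> 0" "\<And>d. d \<in> F \<Longrightarrow> \<bar>blinfun_apply u d\<bar> < e"
          using xy(1) unfolding P_def by blast
        obtain c' s' u' where y: "y = c' + s' *\<^sub>R (u' - \<phi>)" "c' \<in> ?C" "s' \<ge> 0" "\<And>d. d \<in> F \<Longrightarrow> \<bar>blinfun_apply u' d\<bar> < e"
          using xy(2) unfolding P_def by blast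
        show ?thesis
        proof (cases "s + s' = 0")
          case True
          then have "s = 0" "s' = 0" using x(3) y(3) by auto
          then show ?thesis
            using PI[OF convex_cone_add[OF C x(2) y(2)], of 0 0] e by (simp add: x(1) y(1))
        next
          case False
          define a where "a = s / (s + s')"
          have a: "0 \<le> a" "a \<le> 1" using x(3) y(3) False by (auto simp: a_def)
          define v where "v = a *\<^sub>R u + (1 - a) *\<^sub>R u'"
          have "\<bar>v d\<bar> < e" if "d \<in> F" for d
          proof -
            have "a *\<^sub>R u d + (1 - a) *\<^sub>R u' d \<in> {-e<..<e}"
              using a x(4)[OF that] y(4)[OF that]
              by (intro convexD) (auto simp: abs_less_iff convex_real_interval)
            then show ?thesis
              by (simp add: v_def blinfun.add_left blinfun.scaleR_left abs_less_iff)
          qed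
          then have "(c + c') + (s + s') *\<^sub>R (v - \<phi>) \<in> P"
            using x y C by (intro PI) (auto simp: convex_cone_add)
          moreover have "(s + s') *\<^sub>R v = s *\<^sub>R u + s' *\<^sub>R u'"
          proof -
            have "(s + s') * a = s" "(s + s') * (1 - a) = s'"
              using False by (simp_all add: a_def field_simps)
            then show ?thesis by (simp add: v_def scaleR_add_right)
          qed
          ultimately show ?thesis by (simp add: x(1) y(1) algebra_simps)
        qed
      qed
    qed
    moreover have unit: "\<exists>s>0. - \<phi> + s *\<^sub>R v \<in> P" for v
    proof -
      define m where "m = Max (insert 0 ((\<lambda>d. \<bar>v d\<bar>) ` F))"
      have m: "0 \<le> m" "\<And>d. d \<in> F \<Longrightarrow> \<bar>v d\<bar> \<le> m" using F by (simp_all add: m_def)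
      define s where "s = e / (m + 1)"
      have s: "s > 0" using e m(1) by (simp add: s_def)
      have "\<bar>(s *\<^sub>R v) d\<bar> < e" if "d \<in> F" for d
      proof -
        have "s * \<bar>v d\<bar> < s * (m + 1)" using m(2)[OF that] s by simp
        then show ?thesis using s m(1) e by (simp add: blinfun.scaleR_left abs_mult s_def)
      qed
      then have "0 + 1 *\<^sub>R (s *\<^sub>R v - \<phi>) \<in> P" by (intro PI zero) auto
      then show ?thesis using s by auto
    qed
    moreover have "- (- \<phi>) \<notin> P"
    proof
      assume "- (- \<phi>) \<in> P"
      then obtain c s u where *: "\<phi> = c + s *\<^sub>R (u - \<phi>)" "c \<in> ?C" "s \<ge> 0" "\<And>d. d \<in> F \<Longrightarrow> \<bar>blinfun_apply u d\<bar> < e"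
        unfolding P_def by auto
      define \<psi> where "\<psi> = (1 / (1 + s)) *\<^sub>R c"
      have "\<psi> \<in> ?C" using *(2,3) C by (auto simp: \<psi>_def intro: convex_cone_scaleR)
      moreover have "\<psi> \<in> U"
      proof (rule nbh)
        fix d assume d: "d \<in> F"
        have "(1 + s) * \<phi> d = c d + s * u d"
          using arg_cong[OF *(1), of "\<lambda>f. blinfun_apply f d"]
          by (simp add: blinfun.add_left blinfun.scaleR_left blinfun.diff_left algebra_simps)
        then have "\<psi> d - \<phi> d = - (s / (1 + s)) * u d"
          using *(3) by (simp add: \<psi>_def blinfun.scaleR_left field_simps)
        then have "\<bar>\<psi> d - \<phi> d\<bar> = s / (1 + s) * \<bar>u d\<bar>" using *(3) by (simp add: abs_mult)
        also have "\<dots> \<le> 1 * \<bar>u d\<bar>" using *(3) by (intro mult_right_mono) auto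
        finally show "\<bar>\<psi> d - \<phi> d\<bar> < e" using *(4)[OF d] by simp
      qed
      ultimately show False using U(3) by blast
    qed
    ultimately obtain l :: "('a \<Rightarrow>\<^sub>L real) \<Rightarrow> real"
      where lin: "linear l" and l_unit: "l (- \<phi>) = 1" and l_pos: "\<And>p. p \<in> P \<Longrightarrow> l p \<ge> 0"
      by (rule order_unit_separation) blast
    have "\<exists>a. \<forall>v. l v = (\<Sum>d\<in>F. a d * blinfun_apply v d)"
    proof (rule functional_in_span_of_common_kernel[OF F lin])
      show "linear (\<lambda>v. blinfun_apply v d)" for d
        by (rule linearI) (simp_all add: blinfun.add_left blinfun.scaleR_left)
      fix v :: "'a \<Rightarrow>\<^sub>L real" assume v: "\<And>d. d \<in> F \<Longrightarrow> v d = 0"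
      have bound: "k * l v \<ge> - 1" for k
      proof -
        have "0 + 1 *\<^sub>R (k *\<^sub>R v - \<phi>) \<in> P" using v e by (intro PI zero) (auto simp: blinfun.scaleR_left)
        from l_pos[OF this] show ?thesis
          using l_unit by (simp add: linear_diff[OF lin] linear_scale[OF lin] linear_neg[OF lin])
      qed
      show "l v = 0"
        using bound[of "- 2 / l v"] by (cases "l v = 0") auto
    qed
    then obtain a where a: "\<And>v. l v = (\<Sum>d\<in>F. a d * blinfun_apply v d)" by blast
    define d0 where "d0 = - (\<Sum>d\<in>F. a d *\<^sub>R d)"
    have eval: "blinfun_apply v d0 = - l v" for v
      by (simp add: d0_def a blinfun.minus_right blinfun.sum_right blinfun.scaleR_right)
    have "s d0 \<le> 0" if "s \<in> S" for s
    proof -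
      have "s + 0 *\<^sub>R (0 - \<phi>) \<in> P" using that S e by (intro PI) auto
      then show ?thesis using l_pos[of s] by (simp add: eval)
    qed
    then have "\<phi> d0 \<le> 0" using \<phi>(1) by blast
    then show False using l_unit by (simp add: eval linear_neg[OF lin])
  qed
qed

section \<open>Subdifferentials of indicators and uniform linearizations\<close>

lemma frechet_subdifferential_indicator_iff:
  fixes u :: "'x::real_normed_vector"
  shows "x' \<in> frechet_subdifferential \<epsilon> (set_indicator \<Omega>) u \<longleftrightarrow>
    u \<in> \<Omega> \<and> (\<forall>e>0. \<exists>\<rho>>0. \<forall>x\<in>\<Omega>. norm (x - u) \<le> \<rho> \<longrightarrow> x' (x - u) \<le> (\<epsilon> + e) * norm (x - u))"
proof (cases "u \<in> \<Omega>")
  case True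
  let ?q = "\<lambda>x. (set_indicator \<Omega> x - set_indicator \<Omega> u - ereal (x' (x - u))) / ereal (norm (x - u))"
  have q_in: "?q x = ereal (- x' (x - u) / norm (x - u))" if "x \<in> \<Omega>" "x \<noteq> u" for x
    using that True by (simp add: set_indicator_def zero_ereal_def)
  have q_out: "?q x = \<infinity>" if "x \<notin> \<Omega>" "x \<noteq> u" for x
    using that True by (simp add: set_indicator_def zero_ereal_def)
  have q_gt: "ereal (- \<epsilon> - e) < ?q x \<longleftrightarrow> (x \<in> \<Omega> \<longrightarrow> x' (x - u) < (\<epsilon> + e) * norm (x - u))"
    if "x \<noteq> u" for e x
    using that by (cases "x \<in> \<Omega>") (simp_all add: q_in q_out divide_simps algebra_simps)
  have "x' \<in> frechet_subdifferential \<epsilon> (set_indicator \<Omega>) u \<longleftrightarrow>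
      (\<forall>y<ereal (- \<epsilon>). \<forall>\<^sub>F x in at u. y < ?q x)"
    using True by (simp add: frechet_subdifferential_def set_indicator_def le_Liminf_iff)
  also have "\<dots> \<longleftrightarrow> (\<forall>e>0. \<exists>\<rho>>0. \<forall>x\<in>\<Omega>. norm (x - u) \<le> \<rho> \<longrightarrow> x' (x - u) \<le> (\<epsilon> + e) * norm (x - u))"
    (is "?L \<longleftrightarrow> ?R")
  proof (intro iffI allI impI)
    fix e :: real assume L: ?L and e: "e > 0"
    then have "\<forall>\<^sub>F x in at u. ereal (- \<epsilon> - e) < ?q x" by simp
    then obtain \<rho> where \<rho>: "\<rho> > 0" "\<And>x. x \<noteq> u \<Longrightarrow> dist x u < \<rho> \<Longrightarrow> ereal (- \<epsilon> - e) < ?q x"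
      unfolding eventually_at by auto
    have "x' (x - u) \<le> (\<epsilon> + e) * norm (x - u)" if "x \<in> \<Omega>" "norm (x - u) \<le> \<rho> / 2" for x
    proof (cases "x = u")
      case False
      have "dist x u < \<rho>" using that(2) \<rho>(1) by (simp add: dist_norm)
      then show ?thesis using \<rho>(2)[OF False] q_gt[OF False] that(1) by force
    qed simp
    then show "\<exists>\<rho>>0. \<forall>x\<in>\<Omega>. norm (x - u) \<le> \<rho> \<longrightarrow> x' (x - u) \<le> (\<epsilon> + e) * norm (x - u)"
      using \<rho>(1) by (intro exI[of _ "\<rho> / 2"]) simp
  next
    fix y assume R: ?R and y: "y < ereal (- \<epsilon>)"
    then obtain z where z: "y < ereal z" "ereal z < ereal (- \<epsilon>)" using ereal_dense2 by blast
    define e where "e = (- \<epsilon> - z) / 2"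
    have e: "e > 0" "z = - \<epsilon> - 2 * e" using z(2) by (simp_all add: e_def field_simps)
    from R e(1) obtain \<rho> where \<rho>: "\<rho> > 0"
      "\<And>x. x \<in> \<Omega> \<Longrightarrow> norm (x - u) \<le> \<rho> \<Longrightarrow> x' (x - u) \<le> (\<epsilon> + e) * norm (x - u)" by blast
    have "ereal z < ?q x" if "x \<noteq> u" "dist x u < \<rho>" for x
    proof -
      have "x' (x - u) < (\<epsilon> + 2 * e) * norm (x - u)" if "x \<in> \<Omega>"
      proof -
        have "x' (x - u) \<le> (\<epsilon> + e) * norm (x - u)"
          using \<rho>(2)[OF that] \<open>dist x u < \<rho>\<close> by (simp add: dist_norm)
        also have "\<dots> < (\<epsilon> + 2 * e) * norm (x - u)"
          using e(1) \<open>x \<noteq> u\<close> by (intro mult_strict_right_mono) auto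
        finally show ?thesis .
      qed
      then show ?thesis unfolding e(2) using q_gt[OF that(1), of "2 * e"] by blast
    qed
    then show "\<forall>\<^sub>F x in at u. y < ?q x"
      unfolding eventually_at using \<rho>(1) z(1) by (meson less_trans)
  qed
  finally show ?thesis using True by simp
qed (simp add: frechet_subdifferential_def set_indicator_def)

lemma frechet_subset_limiting_normal_cone: "frechet_normal_cone u \<Omega> \<subseteq> limiting_normal_cone u \<Omega>"
proof
  fix x' assume "x' \<in> frechet_normal_cone u \<Omega>"
  then show "x' \<in> limiting_normal_cone u \<Omega>"
    unfolding frechet_normal_cone_def limiting_normal_cone_def limiting_subdifferential_def
    by (intro CollectI exI[of _ "\<lambda>_. u"] exI[of _ "\<lambda>_. 0 :: real"] exI[of _ "\<lambda>_. x'"])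
      (simp add: decseq_def strong_operator_topology_topspace)
qed

lemma limitin_weak_star_pointwise:
  assumes "limitin weak_star f \<phi> F"
  shows "((\<lambda>n. blinfun_apply (f n) d) \<longlongrightarrow> blinfun_apply \<phi> d) F"
  using continuous_map_limit[OF strong_operator_topology_continuous_evaluation[of d] assms]
  by (simp add: o_def)

text \<open>
  A common form of the two uniform differentiability conditions. Uniform Frechet differentiability
  is the case \<open>S = {xbar}\<close>, and uniform strict differentiability gives the property for every
  set \<open>S\<close> of points where the functions are finite. The Frechet and the limiting normal cone are
  treated by one argument with base points in \<open>S\<close>.
\<close>
definition uniform_linearization ::
  "'t set \<Rightarrow> ('t \<Rightarrow> 'x::real_normed_vector \<Rightarrow> ereal) \<Rightarrow> ('t \<Rightarrow> 'x \<Rightarrow>\<^sub>L real) \<Rightarrow> 'x \<Rightarrow> 'x set \<Rightarrow> bool" where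
  "uniform_linearization T g dg xbar S \<longleftrightarrow>
     (\<forall>\<eta>>0. \<exists>\<rho>>0. \<forall>t\<in>T. \<forall>u\<in>S \<inter> cball xbar \<rho>. \<forall>x\<in>cball xbar \<rho>.
        \<bar>g t x - g t u - ereal (dg t (x - u))\<bar> \<le> ereal (\<eta> * norm (x - u)))"

lemma uniform_linearizationE:
  assumes "uniform_linearization T g dg xbar S" "\<eta> > 0"
  obtains \<rho> where "\<rho> > 0" "\<And>t u x. \<lbrakk>t \<in> T; u \<in> S; u \<in> cball xbar \<rho>; x \<in> cball xbar \<rho>\<rbrakk> \<Longrightarrow>
      \<bar>g t x - g t u - ereal (dg t (x - u))\<bar> \<le> ereal (\<eta> * norm (x - u))"
  using assms unfolding uniform_linearization_def by (meson IntI)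

lemma ereal_le_of_quotient_less:
  fixes a :: ereal
  assumes "e2ennreal (\<bar>a\<bar> / ereal b) < ennreal c" "b > 0" "c > 0"
  shows "\<bar>a\<bar> \<le> ereal (c * b)"
proof -
  have "\<bar>a\<bar> / ereal b \<ge> 0" using assms(2) by (intro zero_le_divide_ereal) auto
  then have "\<bar>a\<bar> / ereal b < ereal c"
    using assms(1,3) by (metis enn2ereal_e2ennreal enn2ereal_ennreal less_ennreal.rep_eq less_imp_le)
  then show ?thesis
    using assms(2) by (cases a) (simp_all add: divide_simps mult.commute)
qed

lemma uniform_linearization_of_frechet:
  assumes "uniformly_frechet_differentiable T g dg xbar"
    and finite: "\<And>t. t \<in> T \<Longrightarrow> \<bar>g t xbar\<bar> \<noteq> \<infinity>"
  shows "uniform_linearization T g dg xbar {xbar}"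
  unfolding uniform_linearization_def
proof (intro allI impI)
  fix \<eta> :: real assume \<eta>: "\<eta> > 0"
  then have "\<forall>\<^sub>F r in at_right 0. frechet_modulus T g dg xbar r < ennreal \<eta>"
    using assms(1) unfolding uniformly_frechet_differentiable_def by (intro order_tendstoD) auto
  then obtain b where b: "b > 0" "\<And>r. 0 < r \<Longrightarrow> r < b \<Longrightarrow> frechet_modulus T g dg xbar r < ennreal \<eta>"
    unfolding eventually_at_right_field by auto
  define \<rho> where "\<rho> = b / 2"
  have \<rho>: "\<rho> > 0" "frechet_modulus T g dg xbar \<rho> < ennreal \<eta>" using b by (simp_all add: \<rho>_def)
  have "\<bar>g t x - g t xbar - ereal (dg t (x - xbar))\<bar> \<le> ereal (\<eta> * norm (x - xbar))"
    if t: "t \<in> T" and x: "x \<in> cball xbar \<rho>" for t x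
  proof (cases "x = xbar")
    case True
    then show ?thesis using finite[OF t] by (cases "g t xbar") (simp_all add: zero_ereal_def)
  next
    case False
    then have "e2ennreal (\<bar>g t x - g t xbar - ereal (dg t (x - xbar))\<bar> / ereal (norm (x - xbar)))
        \<le> frechet_modulus T g dg xbar \<rho>"
      unfolding frechet_modulus_def using t x by (intro SUP_upper2[of t] SUP_upper2[of x]) auto
    then show ?thesis
      using \<rho>(2) \<eta> False by (intro ereal_le_of_quotient_less) auto
  qed
  then show "\<exists>\<rho>>0. \<forall>t\<in>T. \<forall>u\<in>{xbar} \<inter> cball xbar \<rho>. \<forall>x\<in>cball xbar \<rho>.
      \<bar>g t x - g t u - ereal (dg t (x - u))\<bar> \<le> ereal (\<eta> * norm (x - u))"
    using \<rho>(1) by (intro exI[of _ \<rho>]) blast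
qed

lemma uniform_linearization_of_strict:
  assumes "uniformly_strictly_differentiable T g dg xbar"
    and finite: "\<And>t u. t \<in> T \<Longrightarrow> u \<in> S \<Longrightarrow> \<bar>g t u\<bar> \<noteq> \<infinity>"
  shows "uniform_linearization T g dg xbar S"
  unfolding uniform_linearization_def
proof (intro allI impI)
  fix \<eta> :: real assume \<eta>: "\<eta> > 0"
  then have "\<forall>\<^sub>F r in at_right 0. strict_modulus T g dg xbar r < ennreal \<eta>"
    using assms(1) unfolding uniformly_strictly_differentiable_def by (intro order_tendstoD) auto
  then obtain b where b: "b > 0" "\<And>r. 0 < r \<Longrightarrow> r < b \<Longrightarrow> strict_modulus T g dg xbar r < ennreal \<eta>"
    unfolding eventually_at_right_field by auto
  define \<rho> where "\<rho> = b / 2"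
  have \<rho>: "\<rho> > 0" "strict_modulus T g dg xbar \<rho> < ennreal \<eta>" using b by (simp_all add: \<rho>_def)
  have "\<bar>g t x - g t u - ereal (dg t (x - u))\<bar> \<le> ereal (\<eta> * norm (x - u))"
    if t: "t \<in> T" and u: "u \<in> S" "u \<in> cball xbar \<rho>" and x: "x \<in> cball xbar \<rho>" for t u x
  proof (cases "x = u")
    case True
    then show ?thesis using finite[OF t u(1)] by (cases "g t u") (simp_all add: zero_ereal_def)
  next
    case False
    then have "e2ennreal (\<bar>g t x - g t u - ereal (dg t (x - u))\<bar> / ereal (norm (x - u)))
        \<le> strict_modulus T g dg xbar \<rho>"
      unfolding strict_modulus_def using t u(2) x by (intro SUP_upper2[of t] SUP_upper2[of "(x, u)"]) auto
    then show ?thesis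
      using \<rho>(2) \<eta> False by (intro ereal_le_of_quotient_less) auto
  qed
  then show "\<exists>\<rho>>0. \<forall>t\<in>T. \<forall>u\<in>S \<inter> cball xbar \<rho>. \<forall>x\<in>cball xbar \<rho>.
      \<bar>g t x - g t u - ereal (dg t (x - u))\<bar> \<le> ereal (\<eta> * norm (x - u))"
    using \<rho>(1) by (intro exI[of _ \<rho>]) blast
qed

section \<open>Systems satisfying the perturbed Mangasarian-Fromovitz condition\<close>

text \<open>
  The hypotheses in the quantitative form in which they are used: \<open>G\<close> bounds the gradients, and
  \<open>xt\<close> decreases all \<open>\<epsilon>0\<close>-active constraints at rate at least \<open>\<delta>\<close>.
\<close>
locale regular_system =
  fixes T :: "'t set" and g :: "'t \<Rightarrow> 'x::banach \<Rightarrow> ereal" and h :: "'x \<Rightarrow> 'y::banach"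
    and dg :: "'t \<Rightarrow> 'x \<Rightarrow>\<^sub>L real" and dh :: "'x \<Rightarrow>\<^sub>L 'y" and xbar xt :: 'x and \<epsilon>0 \<delta> G :: real
  assumes xbar_feasible: "xbar \<in> feasible_set T g h"
    and strict: "has_strict_derivative h dh xbar"
    and surj: "surj (blinfun_apply dh)"
    and G: "G \<ge> 0" "\<And>t. t \<in> T \<Longrightarrow> norm (dg t) \<le> G"
    and finite_at: "\<And>t. t \<in> T \<Longrightarrow> \<bar>g t xbar\<bar> \<noteq> \<infinity>"
    and pos: "\<epsilon>0 > 0" "\<delta> > 0"
    and xt_kernel: "dh xt = 0"
    and xt_decrease: "\<And>t. t \<in> active_indices T g xbar \<epsilon>0 \<Longrightarrow> dg t xt \<le> - \<delta>"
    and linearization: "uniform_linearization T g dg xbar {xbar}"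
begin

abbreviation "\<Omega> \<equiv> feasible_set T g h"

text \<open>
  A single cone whose polar is the intersection over all \<open>\<epsilon>\<close> in the formula: it is the
  union of the polars of the families of \<open>\<epsilon>\<close>-active gradients, and these polars grow as \<open>\<epsilon>\<close>
  decreases.
\<close>
definition critical_cone :: "'x set" where
  "critical_cone = {d. \<exists>\<epsilon>>0. \<forall>t\<in>active_indices T g xbar \<epsilon>. dg t d \<le> 0}"

abbreviation critical_polar :: "('x \<Rightarrow>\<^sub>L real) set" where
  "critical_polar \<equiv> {\<mu>. \<forall>d\<in>critical_cone. blinfun_apply \<mu> d \<le> 0}"

lemma active_indices_mono: "\<epsilon> \<le> \<epsilon>' \<Longrightarrow> active_indices T g xbar \<epsilon> \<subseteq> active_indices T g xbar \<epsilon>'"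
  unfolding active_indices_def by (auto elim: order_trans[rotated])

lemma multipliers_eq_polar:
  "(\<Inter>\<epsilon>\<in>{0<..}. weak_star closure_of generated_cone (dg ` active_indices T g xbar \<epsilon>))
    = critical_polar"
  by (auto simp: weak_star_closure_generated_cone critical_cone_def)

lemma convex_cone_critical_cone: "convex_cone critical_cone"
  unfolding convex_cone_iff
proof (intro conjI ballI allI impI)
  show "0 \<in> critical_cone" by (auto simp: critical_cone_def intro: exI[of _ 1])
  show "x + y \<in> critical_cone" if xy: "x \<in> critical_cone" "y \<in> critical_cone" for x y
  proof -
    obtain \<epsilon> where \<epsilon>: "\<epsilon> > 0" "\<And>t. t \<in> active_indices T g xbar \<epsilon> \<Longrightarrow> dg t x \<le> 0"
      using xy(1) unfolding critical_cone_def by blast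
    obtain \<epsilon>' where \<epsilon>': "\<epsilon>' > 0" "\<And>t. t \<in> active_indices T g xbar \<epsilon>' \<Longrightarrow> dg t y \<le> 0"
      using xy(2) unfolding critical_cone_def by blast
    have "dg t (x + y) \<le> 0" if "t \<in> active_indices T g xbar (min \<epsilon> \<epsilon>')" for t
    proof -
      have "t \<in> active_indices T g xbar \<epsilon>" "t \<in> active_indices T g xbar \<epsilon>'"
        using subsetD[OF active_indices_mono that] by simp_all
      then show ?thesis using \<epsilon>(2) \<epsilon>'(2) by (simp add: blinfun.add_right add_nonpos_nonpos)
    qed
    then show ?thesis using \<epsilon>(1) \<epsilon>'(1) unfolding critical_cone_def by (auto intro!: exI[of _ "min \<epsilon> \<epsilon>'"])
  qed
  show "c *\<^sub>R x \<in> critical_cone" if "x \<in> critical_cone" "0 \<le> c" for x c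
    using that unfolding critical_cone_def by (auto simp: blinfun.scaleR_right mult_nonneg_nonpos)
qed

lemma cball_subset_critical_cone: "cball xt (\<delta> / (G + 1)) \<subseteq> critical_cone"
proof
  fix d assume d: "d \<in> cball xt (\<delta> / (G + 1))"
  have "dg t d \<le> 0" if t: "t \<in> active_indices T g xbar \<epsilon>0" for t
  proof -
    have "dg t (d - xt) \<le> norm (dg t) * norm (d - xt)" using norm_blinfun[of "dg t" "d - xt"] by simp
    also have "\<dots> \<le> (G + 1) * (\<delta> / (G + 1))"
    proof (rule mult_mono)
      show "norm (dg t) \<le> G + 1" using G(2)[of t] t by (simp add: active_indices_def)
      show "norm (d - xt) \<le> \<delta> / (G + 1)" using d by (simp add: dist_norm norm_minus_commute)
    qed (use G(1) in auto)
    also have "\<dots> = \<delta>" using G(1) by simp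
    finally show ?thesis using xt_decrease[OF t] by (simp add: blinfun.diff_right)
  qed
  then show "d \<in> critical_cone" using pos(1) unfolding critical_cone_def by blast
qed

lemma h_xbar: "h xbar = 0"
  using xbar_feasible by (simp add: feasible_set_def)

text \<open>
  If \<open>x\<close> is feasible, then the linearized constraints that are \<open>\<epsilon>\<close>-active increase by at most
  \<open>\<epsilon> + o(norm (x - xbar))\<close> from \<open>xbar\<close> to \<open>x\<close>, and a multiple of \<open>xt\<close> of this size moves \<open>x - xbar\<close>
  into the critical cone. Thus the value at \<open>x - xbar\<close> of a functional in its polar cone is at most of
  this order, and \<open>\<epsilon>\<close> is arbitrary.
\<close>
lemma polar_plus_adjoint_subset_frechet_normal_cone:
  assumes polar: "\<And>d. d \<in> critical_cone \<Longrightarrow> blinfun_apply \<mu> d \<le> 0"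
  shows "\<mu> + adjoint_map dh y' \<in> frechet_normal_cone xbar \<Omega>"
  unfolding frechet_normal_cone_def frechet_subdifferential_indicator_iff
proof (intro conjI allI impI xbar_feasible)
  fix e :: real assume e: "e > 0"
  \<comment> \<open>\<open>\<eta>1\<close> and \<open>\<eta>2\<close> make the contributions of the equation and of the inequalities at most
      \<open>e / 2 * norm (x - xbar)\<close> each.\<close>
  define B where "B = - \<mu> xt"
  have "xt \<in> critical_cone" using cball_subset_critical_cone pos(2) G(1) by (auto simp: subset_iff)
  then have B: "B \<ge> 0" using polar by (simp add: B_def)
  define \<eta>1 where "\<eta>1 = e / 2 / (norm y' + 1)"
  define \<eta>2 where "\<eta>2 = \<delta> * (e / 2) / (B + 1)"
  have \<eta>: "\<eta>1 > 0" "\<eta>2 > 0" using e B pos by (simp_all add: \<eta>1_def \<eta>2_def add_nonneg_pos)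
  obtain \<rho>1 where \<rho>1: "\<rho>1 > 0" "\<And>x x'. x \<in> cball xbar \<rho>1 \<Longrightarrow> x' \<in> cball xbar \<rho>1 \<Longrightarrow>
      norm (h x - h x' - dh (x - x')) \<le> \<eta>1 * norm (x - x')"
    using strict_derivative_increment_bound[OF strict \<eta>(1)] by blast
  obtain \<rho>2 where \<rho>2: "\<rho>2 > 0" "\<And>t x. t \<in> T \<Longrightarrow> x \<in> cball xbar \<rho>2 \<Longrightarrow>
      \<bar>g t x - g t xbar - ereal (dg t (x - xbar))\<bar> \<le> ereal (\<eta>2 * norm (x - xbar))"
    using linearization \<eta>(2) unfolding uniform_linearization_def by fastforce
  have "(\<mu> + adjoint_map dh y') (x - xbar) \<le> (0 + e) * norm (x - xbar)"
    if x: "x \<in> \<Omega>" "norm (x - xbar) \<le> min \<rho>1 \<rho>2" for x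
  proof -
    define n where "n = norm (x - xbar)"
    have x_ball: "x \<in> cball xbar \<rho>1" "x \<in> cball xbar \<rho>2"
      using x(2) by (simp_all add: dist_norm norm_minus_commute)
    have "norm (dh (x - xbar)) \<le> \<eta>1 * n"
      using \<rho>1(2)[OF x_ball(1), of xbar] \<rho>1(1) x(1) h_xbar by (simp add: feasible_set_def n_def)
    then have "norm y' * norm (dh (x - xbar)) \<le> (norm y' + 1) * (\<eta>1 * n)"
      by (intro mult_mono) auto
    also have "\<dots> = e / 2 * n"
    proof -
      have "norm y' + 1 \<noteq> 0" by (simp add: add_nonneg_eq_0_iff)
      from nonzero_mult_div_cancel_left[OF this, of "e / 2"]
      have "(norm y' + 1) * \<eta>1 = e / 2" by (simp only: \<eta>1_def times_divide_eq_right)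
      then show ?thesis by (simp only: mult.assoc [symmetric])
    qed
    finally have "y' (dh (x - xbar)) \<le> e / 2 * n"
      using norm_blinfun[of y' "dh (x - xbar)"] by simp
    moreover have "\<mu> (x - xbar) \<le> e / 2 * n"
    proof -
      have "\<mu> (x - xbar) \<le> \<eta>2 * n / \<delta> * B + \<epsilon> * (B / \<delta>)" if \<epsilon>: "0 < \<epsilon>" "\<epsilon> < \<epsilon>0" for \<epsilon>
      proof -
        define k where "k = (\<epsilon> + \<eta>2 * n) / \<delta>"
        have k: "k \<ge> 0" using \<epsilon> \<eta> pos by (simp add: k_def n_def)
        have "dg t (x - xbar + k *\<^sub>R xt) \<le> 0" if t: "t \<in> active_indices T g xbar \<epsilon>" for t
        proof -
          have "t \<in> T" "g t xbar \<ge> ereal (- \<epsilon>)" using t by (simp_all add: active_indices_def)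
          moreover have "g t x \<le> 0" using x(1) \<open>t \<in> T\<close> by (simp add: feasible_set_def)
          ultimately have "dg t (x - xbar) \<le> \<epsilon> + \<eta>2 * n"
            using \<rho>2(2)[OF \<open>t \<in> T\<close> x_ball(2)] finite_at[OF \<open>t \<in> T\<close>]
            by (cases "g t x"; cases "g t xbar") (auto simp: n_def)
          moreover have "k * dg t xt \<le> k * (- \<delta>)"
            using xt_decrease t active_indices_mono[of \<epsilon> \<epsilon>0] \<epsilon> k by (intro mult_left_mono) auto
          moreover have "k * \<delta> = \<epsilon> + \<eta>2 * n" using pos by (simp add: k_def)
          ultimately show ?thesis by (simp add: blinfun.add_right blinfun.scaleR_right)
        qed
        then have "x - xbar + k *\<^sub>R xt \<in> critical_cone"
          using \<epsilon>(1) unfolding critical_cone_def by blast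
        then have "\<mu> (x - xbar) \<le> k * B"
          using polar by (force simp: blinfun.add_right blinfun.scaleR_right B_def)
        then show ?thesis by (simp add: k_def add_divide_distrib algebra_simps)
      qed
      then have "\<forall>\<^sub>F \<epsilon> in at_right 0. \<mu> (x - xbar) \<le> \<eta>2 * n / \<delta> * B + \<epsilon> * (B / \<delta>)"
        unfolding eventually_at_right_field using pos(1) by blast
      moreover have "((\<lambda>\<epsilon>. \<eta>2 * n / \<delta> * B + \<epsilon> * (B / \<delta>)) \<longlongrightarrow> \<eta>2 * n / \<delta> * B + 0 * (B / \<delta>)) (at_right 0)"
        by (intro tendsto_intros)
      ultimately have "\<mu> (x - xbar) \<le> \<eta>2 * n / \<delta> * B + 0 * (B / \<delta>)"
        by (intro tendsto_lowerbound) auto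
      also have "\<dots> = e / 2 * n * (B / (B + 1))" using pos B by (simp add: \<eta>2_def)
      also have "\<dots> \<le> e / 2 * n * 1" using B e by (intro mult_left_mono) (auto simp: n_def)
      finally show ?thesis by simp
    qed
    ultimately show ?thesis by (simp add: adjoint_map_def blinfun.add_left n_def)
  qed
  then show "\<exists>\<rho>>0. \<forall>x\<in>\<Omega>. norm (x - xbar) \<le> \<rho> \<longrightarrow>
      (\<mu> + adjoint_map dh y') (x - xbar) \<le> (0 + e) * norm (x - xbar)"
    using \<rho>1(1) \<rho>2(1) by (intro exI[of _ "min \<rho>1 \<rho>2"]) auto
qed

text \<open>
  Moving from \<open>u\<close> by \<open>\<tau> d\<close> violates the equation by \<open>o(\<tau>)\<close> only, uniformly in \<open>u\<close>, and the
  Lyusternik-Graves theorem restores it by a correction of that order. The \<open>\<epsilon>\<close>-active constraints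
  absorb the correction because they decrease at rate \<open>\<alpha>\<close>. The other ones are below \<open>- \<epsilon>\<close> at \<open>xbar\<close>
  and vary at a bounded rate, so they stay nonpositive nearby.
\<close>
lemma feasible_curve:
  assumes base: "S \<subseteq> \<Omega>" "uniform_linearization T g dg xbar S"
    and d: "dh d = 0" and \<epsilon>: "\<epsilon> > 0" and \<alpha>: "\<alpha> > 0"
    and decrease: "\<And>t. t \<in> active_indices T g xbar \<epsilon> \<Longrightarrow> dg t d \<le> - \<alpha>"
    and \<eta>: "\<eta> > 0"
  obtains \<rho> \<tau>0 where "\<rho> > 0" "\<tau>0 > 0"
    "\<And>u \<tau>. \<lbrakk>u \<in> S; u \<in> cball xbar \<rho>; 0 < \<tau>; \<tau> \<le> \<tau>0\<rbrakk> \<Longrightarrow>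
      \<exists>w. norm w \<le> \<eta> * \<tau> \<and> u + \<tau> *\<^sub>R d + w \<in> \<Omega>"
proof -
  define N where "N = norm d"
  have N: "N \<ge> 0" by (simp add: N_def)
  \<comment> \<open>\<open>\<eta>'\<close> bounds the size of the correction and \<open>\<kappa>\<close> the error of linearization: together they cost
      at most \<open>\<alpha> / 2 + \<alpha> / 2\<close> of the decrease.\<close>
  define \<eta>' where "\<eta>' = min \<eta> (\<alpha> / 2 / (G + 1))"
  have \<eta>': "\<eta>' > 0" "\<eta>' \<le> \<eta>" "(G + 1) * \<eta>' \<le> \<alpha> / 2"
  proof -
    show "\<eta>' > 0" "\<eta>' \<le> \<eta>" using \<eta> \<alpha> G(1) by (simp_all add: \<eta>'_def)
    have "(G + 1) * \<eta>' \<le> (G + 1) * (\<alpha> / 2 / (G + 1))"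
      using G(1) by (intro mult_left_mono) (simp_all add: \<eta>'_def)
    also have "\<dots> = \<alpha> / 2"
      using nonzero_mult_div_cancel_left[of "G + 1" "\<alpha> / 2"] G(1) by (simp only: times_divide_eq_right)
    finally show "(G + 1) * \<eta>' \<le> \<alpha> / 2" .
  qed
  define \<kappa> where "\<kappa> = \<alpha> / (2 * (N + \<eta>' + 1))"
  have \<kappa>: "\<kappa> > 0" "\<kappa> * (N + \<eta>') \<le> \<alpha> / 2"
    using \<alpha> N \<eta>'(1) by (simp_all add: \<kappa>_def divide_simps add_nonneg_pos)
  obtain c R1 where c: "c > 0" and R1: "R1 > 0"
    and restore: "\<And>x. x \<in> cball xbar R1 \<Longrightarrow> \<exists>w. norm w \<le> c * norm (h x) \<and> h (x + w) = 0"
    using lyusternik_graves[OF strict surj h_xbar] by blast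
  define \<zeta> where "\<zeta> = \<eta>' / (c * (N + 1))"
  have \<zeta>: "\<zeta> > 0" "c * (\<zeta> * N) \<le> \<eta>'"
    using c N \<eta>'(1) by (simp_all add: \<zeta>_def divide_simps add_nonneg_pos)
  obtain R2 where R2: "R2 > 0" "\<And>x x'. x \<in> cball xbar R2 \<Longrightarrow> x' \<in> cball xbar R2 \<Longrightarrow>
      norm (h x - h x' - dh (x - x')) \<le> \<zeta> * norm (x - x')"
    using strict_derivative_increment_bound[OF strict \<zeta>(1)] by blast
  obtain R3 where R3: "R3 > 0" "\<And>t u x. t \<in> T \<Longrightarrow> u \<in> S \<Longrightarrow> u \<in> cball xbar R3 \<Longrightarrow> x \<in> cball xbar R3 \<Longrightarrow>
      \<bar>g t x - g t u - ereal (dg t (x - u))\<bar> \<le> ereal (\<kappa> * norm (x - u))"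
    using uniform_linearizationE[OF base(2) \<kappa>(1)] by blast
  obtain R4 where R4: "R4 > 0" "\<And>t x. t \<in> T \<Longrightarrow> x \<in> cball xbar R4 \<Longrightarrow>
      \<bar>g t x - g t xbar - ereal (dg t (x - xbar))\<bar> \<le> ereal (1 * norm (x - xbar))"
  proof (rule uniform_linearizationE[OF linearization zero_less_one])
    fix \<rho> :: real assume "\<rho> > 0" and
      "\<And>t u x. \<lbrakk>t \<in> T; u \<in> {xbar}; u \<in> cball xbar \<rho>; x \<in> cball xbar \<rho>\<rbrakk> \<Longrightarrow>
        \<bar>g t x - g t u - ereal (dg t (x - u))\<bar> \<le> ereal (1 * norm (x - u))"
    then show thesis by (intro that[of \<rho>]) auto
  qed
  define R where "R = min (min R1 R2) (min (min R3 R4) (\<epsilon> / (G + 1)))"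
  have R: "R > 0" "R \<le> R1" "R \<le> R2" "R \<le> R3" "R \<le> R4" "R \<le> \<epsilon> / (G + 1)"
    using R1 R2(1) R3(1) R4(1) \<epsilon> G(1) by (simp_all add: R_def)
  define \<tau>0 where "\<tau>0 = R / (2 * (N + \<eta>' + 1))"
  have \<tau>0: "\<tau>0 > 0" "\<tau>0 * (N + \<eta>') \<le> R / 2"
    using R(1) N \<eta>'(1) by (simp_all add: \<tau>0_def divide_simps add_nonneg_pos)
  have "\<exists>w. norm w \<le> \<eta> * \<tau> \<and> u + \<tau> *\<^sub>R d + w \<in> \<Omega>"
    if u: "u \<in> S" "u \<in> cball xbar (R / 2)" and \<tau>: "0 < \<tau>" "\<tau> \<le> \<tau>0" for u \<tau>
  proof -
    have in_ball: "u + v \<in> cball xbar R" if "norm v \<le> \<tau> * (N + \<eta>')" for v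
    proof -
      have "\<tau> * (N + \<eta>') \<le> \<tau>0 * (N + \<eta>')" using \<tau>(2) N \<eta>'(1) by (intro mult_right_mono) auto
      with that have "norm v \<le> \<tau>0 * (N + \<eta>')" by (rule order_trans)
      then have "norm v \<le> R / 2" using \<tau>0(2) by simp
      then show ?thesis
        using u(2) norm_triangle_ineq4[of "xbar - u" v] by (simp add: dist_norm algebra_simps)
    qed
    have u_R: "u \<in> cball xbar R" using u(2) R(1) by simp
    have \<tau>d: "u + \<tau> *\<^sub>R d \<in> cball xbar R"
      using \<tau>(1) \<eta>'(1) by (intro in_ball) (simp add: N_def)
    have "h u = 0" using u(1) base(1) by (auto simp: feasible_set_def)
    then have "norm (h (u + \<tau> *\<^sub>R d)) \<le> \<zeta> * (\<tau> * N)"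
      using R2(2)[of "u + \<tau> *\<^sub>R d" u] \<tau>d u_R R(3) \<tau>(1) d by (simp add: blinfun.scaleR_right N_def)
    then have "c * norm (h (u + \<tau> *\<^sub>R d)) \<le> \<tau> * (c * (\<zeta> * N))"
      using c mult_left_mono[of "norm (h (u + \<tau> *\<^sub>R d))" "\<zeta> * (\<tau> * N)" c] by (simp add: mult_ac)
    also have "\<dots> \<le> \<tau> * \<eta>'" using \<zeta>(2) \<tau>(1) by (intro mult_left_mono) auto
    finally obtain w where w: "norm w \<le> \<tau> * \<eta>'" and hw: "h (u + \<tau> *\<^sub>R d + w) = 0"
      using restore[of "u + \<tau> *\<^sub>R d"] \<tau>d R(2) by (auto intro: order_trans)
    define v where "v = \<tau> *\<^sub>R d + w"
    have v: "norm v \<le> \<tau> * (N + \<eta>')"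
      using norm_triangle_ineq[of "\<tau> *\<^sub>R d" w] w \<tau>(1) by (simp add: v_def N_def algebra_simps)
    have x_R: "u + v \<in> cball xbar R" using v by (rule in_ball)
    have "g t (u + v) \<le> 0" if t: "t \<in> T" for t
    proof (cases "t \<in> active_indices T g xbar \<epsilon>")
      case True
      have "dg t w \<le> G * (\<tau> * \<eta>')"
        using norm_blinfun[of "dg t" w] mult_mono[OF G(2)[OF t] w G(1) norm_ge_zero] by simp
      also have "\<dots> \<le> \<tau> * ((G + 1) * \<eta>')" using \<tau>(1) \<eta>'(1) by (simp add: algebra_simps)
      also have "\<dots> \<le> \<tau> * (\<alpha> / 2)" using \<eta>'(3) \<tau>(1) by (intro mult_left_mono) auto
      finally have "dg t w \<le> \<tau> * (\<alpha> / 2)" .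
      moreover have "\<tau> * dg t d \<le> \<tau> * (- \<alpha>)" using decrease[OF True] \<tau>(1) by (intro mult_left_mono) auto
      moreover have "\<kappa> * norm v \<le> \<tau> * (\<alpha> / 2)"
      proof -
        have "\<kappa> * norm v \<le> \<kappa> * (\<tau> * (N + \<eta>'))" using v \<kappa>(1) by (intro mult_left_mono) auto
        also have "\<dots> = \<tau> * (\<kappa> * (N + \<eta>'))" by simp
        also have "\<dots> \<le> \<tau> * (\<alpha> / 2)" using \<kappa>(2) \<tau>(1) by (intro mult_left_mono) auto
        finally show ?thesis .
      qed
      moreover have "\<tau> * (\<alpha> / 2) + \<tau> * (- \<alpha>) + \<tau> * (\<alpha> / 2) = 0" by (simp add: algebra_simps)
      ultimately have "dg t v + \<kappa> * norm v \<le> 0"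
        by (simp add: v_def blinfun.add_right blinfun.scaleR_right)
      moreover have "g t u \<le> 0" using u(1) base(1) t by (auto simp: feasible_set_def)
      moreover have "\<bar>g t (u + v) - g t u - ereal (dg t v)\<bar> \<le> ereal (\<kappa> * norm v)"
        using R3(2)[OF t u(1), of "u + v"] u_R x_R R(4) by simp
      ultimately show ?thesis
        by (cases "g t (u + v)"; cases "g t u") auto
    next
      case False
      define n where "n = norm (u + v - xbar)"
      have "n \<le> \<epsilon> / (G + 1)" using x_R R(6) by (simp add: n_def dist_norm norm_minus_commute)
      then have "G * n + n \<le> \<epsilon>" using G(1) by (simp add: field_simps)
      moreover have "dg t (u + v - xbar) \<le> G * n"
        using norm_blinfun[of "dg t" "u + v - xbar"] mult_right_mono[OF G(2)[OF t], of n] by (simp add: n_def)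
      moreover have "\<bar>g t (u + v) - g t xbar - ereal (dg t (u + v - xbar))\<bar> \<le> ereal (1 * n)"
        unfolding n_def using x_R R(5) by (intro R4(2) t) simp
      moreover have "g t xbar < ereal (- \<epsilon>)" using False t by (simp add: active_indices_def)
      ultimately show ?thesis
        using finite_at[OF t] by (cases "g t (u + v)"; cases "g t xbar") auto
    qed
    then have "u + \<tau> *\<^sub>R d + w \<in> \<Omega>" using hw by (simp add: feasible_set_def v_def add.assoc)
    moreover have "norm w \<le> \<eta> * \<tau>"
      using order_trans[OF w mult_left_mono[OF \<eta>'(2) less_imp_le[OF \<tau>(1)]]] by (simp only: mult.commute)
    ultimately show ?thesis by blast
  qed
  then show thesis using that[of "R / 2" \<tau>0] R(1) \<tau>0(1) by simp
qed

text \<open>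
  Testing the \<open>\<epsilon> n\<close>-normals at \<open>xs n\<close> along the feasible curves in the direction \<open>d + k xt\<close>, which
  decreases the active constraints for every \<open>k > 0\<close>, bounds \<open>x' (d + k xt)\<close> by an arbitrarily small
  number, since the normals are bounded by the uniform boundedness principle.
\<close>
lemma limit_of_normals_nonpositive:
  assumes base: "S \<subseteq> \<Omega>" "uniform_linearization T g dg xbar S"
    and xs: "\<And>n. xs n \<in> S" "xs \<longlonglongrightarrow> xbar"
    and \<epsilon>: "\<epsilon> \<longlonglongrightarrow> 0"
    and normal: "\<And>n. xs' n \<in> frechet_subdifferential (\<epsilon> n) (set_indicator \<Omega>) (xs n)"
    and lim: "\<And>d. (\<lambda>n. blinfun_apply (xs' n) d) \<longlonglongrightarrow> blinfun_apply x' d"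
    and d: "d \<in> critical_cone" "dh d = 0"
  shows "x' d \<le> 0"
proof -
  have "bounded (range (\<lambda>n. xs' n x))" for x using lim[of x] by (rule convergent_imp_bounded)
  then obtain M where M: "\<And>n. norm (xs' n) \<le> M" using uniform_boundedness[of xs'] by blast
  have "M \<ge> 0" using order_trans[OF norm_ge_zero M] .
  from d(1) obtain e1 where e1: "e1 > 0" "\<And>t. t \<in> active_indices T g xbar e1 \<Longrightarrow> dg t d \<le> 0"
    unfolding critical_cone_def by blast
  define e where "e = min e1 \<epsilon>0"
  have e: "e > 0" "e \<le> e1" "e \<le> \<epsilon>0" using e1(1) pos(1) by (simp_all add: e_def)
  have perturbed: "x' (d + k *\<^sub>R xt) \<le> 0" if k: "k > 0" for k
  proof -
    define v where "v = d + k *\<^sub>R xt"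
    have v_kernel: "dh v = 0" using d(2) xt_kernel by (simp add: v_def blinfun.add_right blinfun.scaleR_right)
    have v_decrease: "dg t v \<le> - (k * \<delta>)" if "t \<in> active_indices T g xbar e" for t
    proof -
      have "dg t d \<le> 0" "dg t xt \<le> - \<delta>"
        using that e active_indices_mono[of e] e1(2) xt_decrease by blast+
      then show ?thesis
        using mult_left_mono[of "dg t xt" "- \<delta>" k] k
        by (simp add: v_def blinfun.add_right blinfun.scaleR_right)
    qed
    \<comment> \<open>The correction \<open>w\<close> contributes \<open>\<eta> * M\<close> to the bound; the normal inequality contributes the
        rest, as \<open>\<epsilon> n + \<eta> \<le> 2 * \<eta>\<close> for large \<open>n\<close>.\<close>
    have bound: "x' v \<le> 0 + \<eta> * (M + 2 * (norm v + 1))" if \<eta>: "0 < \<eta>" "\<eta> < 1" for \<eta>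
    proof -
      have "k * \<delta> > 0" using k pos(2) by simp
      then obtain \<rho> \<tau>0 where \<rho>: "\<rho> > 0" "\<tau>0 > 0"
        and curve: "\<And>u \<tau>. \<lbrakk>u \<in> S; u \<in> cball xbar \<rho>; 0 < \<tau>; \<tau> \<le> \<tau>0\<rbrakk> \<Longrightarrow>
          \<exists>w. norm w \<le> \<eta> * \<tau> \<and> u + \<tau> *\<^sub>R v + w \<in> \<Omega>"
        using feasible_curve[OF base v_kernel e(1) _ v_decrease \<eta>(1)] by blast
      have "\<forall>\<^sub>F n in sequentially. dist (xs n) xbar < \<rho>" using xs(2) \<rho>(1) by (rule tendstoD)
      moreover have "\<forall>\<^sub>F n in sequentially. \<epsilon> n < \<eta>" using \<epsilon> \<eta>(1) by (rule order_tendstoD)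
      ultimately have "\<forall>\<^sub>F n in sequentially. xs' n v \<le> 0 + \<eta> * (M + 2 * (norm v + 1))"
      proof eventually_elim
        case (elim n)
        obtain r where r: "r > 0"
          and small: "\<And>x. x \<in> \<Omega> \<Longrightarrow> norm (x - xs n) \<le> r \<Longrightarrow> xs' n (x - xs n) \<le> (\<epsilon> n + \<eta>) * norm (x - xs n)"
          using normal[of n] \<eta>(1) unfolding frechet_subdifferential_indicator_iff by blast
        define \<tau> where "\<tau> = min \<tau>0 (r / (norm v + 1))"
        have \<tau>: "\<tau> > 0" "\<tau> \<le> \<tau>0" "\<tau> * (norm v + 1) \<le> r"
        proof -
          show "\<tau> > 0" "\<tau> \<le> \<tau>0" using \<rho>(2) r by (simp_all add: \<tau>_def add_nonneg_pos)
          have "\<tau> * (norm v + 1) \<le> r / (norm v + 1) * (norm v + 1)"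
            by (intro mult_right_mono) (simp_all add: \<tau>_def)
          also have "\<dots> = r" by (simp add: add_nonneg_eq_0_iff)
          finally show "\<tau> * (norm v + 1) \<le> r" .
        qed
        obtain w where w: "norm w \<le> \<eta> * \<tau>" "xs n + \<tau> *\<^sub>R v + w \<in> \<Omega>"
          using curve[of "xs n" \<tau>] xs(1) \<tau>(1,2) elim(1) by (auto simp: dist_commute)
        define z where "z = \<tau> *\<^sub>R v + w"
        have "norm w \<le> \<tau>"
          using order_trans[OF w(1) mult_left_le_one_le[of \<tau> \<eta>]] \<eta> \<tau>(1) by simp
        then have z: "norm z \<le> \<tau> * (norm v + 1)"
          using norm_triangle_ineq[of "\<tau> *\<^sub>R v" w] \<tau>(1) by (simp add: z_def algebra_simps)
        have "xs' n z \<le> (\<epsilon> n + \<eta>) * norm z"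
          using small[of "xs n + z"] w(2) z \<tau>(3) by (simp add: z_def add.assoc)
        also have "\<dots> \<le> (2 * \<eta>) * norm z" using elim(2) by (intro mult_right_mono) auto
        also have "\<dots> \<le> (2 * \<eta>) * (\<tau> * (norm v + 1))" using z \<eta>(1) by (intro mult_left_mono) auto
        finally have "xs' n z \<le> (2 * \<eta>) * (\<tau> * (norm v + 1))" .
        moreover have "- xs' n w \<le> M * (\<eta> * \<tau>)"
          using norm_blinfun[of "xs' n" w] mult_mono[OF M[of n] w(1) \<open>M \<ge> 0\<close> norm_ge_zero] by simp
        moreover have "xs' n z = \<tau> * xs' n v + xs' n w"
          by (simp add: z_def blinfun.add_right blinfun.scaleR_right)
        ultimately have "\<tau> * xs' n v \<le> \<tau> * (\<eta> * (M + 2 * (norm v + 1)))" by (simp add: algebra_simps)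
        then show ?case using \<tau>(1) by simp
      qed
      then show ?thesis using lim[of v] by (intro tendsto_upperbound) auto
    qed
    have "\<forall>\<^sub>F \<eta> in at_right 0. x' v \<le> 0 + \<eta> * (M + 2 * (norm v + 1))"
      unfolding eventually_at_right_field using bound by (intro exI[of _ 1]) auto
    moreover have "((\<lambda>\<eta>. 0 + \<eta> * (M + 2 * (norm v + 1))) \<longlongrightarrow> 0 + 0 * (M + 2 * (norm v + 1))) (at_right 0)"
      by (intro tendsto_intros)
    ultimately have "x' v \<le> 0 + 0 * (M + 2 * (norm v + 1))" by (intro tendsto_lowerbound) auto
    then show ?thesis by (simp add: v_def)
  qed
  have "\<forall>\<^sub>F k in at_right 0. x' d + k * x' xt \<le> 0"
    unfolding eventually_at_right_field
    using perturbed by (intro exI[of _ 1]) (simp add: blinfun.add_right blinfun.scaleR_right)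
  moreover have "((\<lambda>k. x' d + k * x' xt) \<longlongrightarrow> x' d + 0 * x' xt) (at_right 0)" by (intro tendsto_intros)
  ultimately have "x' d + 0 * x' xt \<le> 0" by (intro tendsto_upperbound) auto
  then show ?thesis by simp
qed

text \<open>
  The critical cone has the interior point \<open>xt\<close> in the kernel of \<open>dh\<close>, so that the restriction of \<open>x'\<close> to
  the kernel extends to a functional in the polar of the critical cone; the difference annihilates the kernel.
  In this way the two summands are obtained directly, without passing to the closure of a sum.
\<close>
lemma nonpositive_on_kernel_decomposition:
  assumes "\<And>d. d \<in> critical_cone \<Longrightarrow> dh d = 0 \<Longrightarrow> blinfun_apply x' d \<le> 0"
  shows "x' \<in> critical_polar + range (adjoint_map dh)"
proof -
  have "subspace {v. dh v = 0}"
    by (simp add: subspace_def blinfun.add_right blinfun.scaleR_right)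
  moreover have "\<delta> / (G + 1) > 0" using pos(2) G(1) by simp
  ultimately obtain \<mu> :: "'x \<Rightarrow>\<^sub>L real" where \<mu>: "\<And>d. d \<in> critical_cone \<Longrightarrow> \<mu> d \<le> 0"
    and eq: "\<And>v. dh v = 0 \<Longrightarrow> \<mu> v = x' v"
    using nonpositive_functional_extension[OF _ convex_cone_critical_cone _ _ cball_subset_critical_cone,
        of "{v. dh v = 0}" x'] assms xt_kernel by auto
  have "x' - \<mu> \<in> range (adjoint_map dh)"
    using surj by (rule annihilator_of_kernel_subset_range_adjoint) (simp add: eq blinfun.diff_left)
  then have "\<mu> + (x' - \<mu>) \<in> critical_polar + range (adjoint_map dh)"
    using \<mu> by (intro set_plus_intro) auto
  then show ?thesis by simp
qed

theorem frechet_normal_cone_eq: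
  "frechet_normal_cone xbar \<Omega> = critical_polar + range (adjoint_map dh)"
proof (rule antisym)
  show "frechet_normal_cone xbar \<Omega> \<subseteq> critical_polar + range (adjoint_map dh)"
  proof
    fix x' assume x': "x' \<in> frechet_normal_cone xbar \<Omega>"
    have "x' d \<le> 0" if "d \<in> critical_cone" "dh d = 0" for d
      by (rule limit_of_normals_nonpositive[where S = "{xbar}" and xs = "\<lambda>_. xbar" and \<epsilon> = "\<lambda>_. 0"
            and xs' = "\<lambda>_. x'"])
        (use that x' xbar_feasible linearization in \<open>simp_all add: frechet_normal_cone_def\<close>)
    then show "x' \<in> critical_polar + range (adjoint_map dh)"
      by (rule nonpositive_on_kernel_decomposition)
  qed
  show "critical_polar + range (adjoint_map dh) \<subseteq> frechet_normal_cone xbar \<Omega>"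
    by (auto elim!: set_plus_elim intro!: polar_plus_adjoint_subset_frechet_normal_cone)
qed

theorem limiting_normal_cone_eq:
  assumes "uniform_linearization T g dg xbar \<Omega>"
  shows "limiting_normal_cone xbar \<Omega> = critical_polar + range (adjoint_map dh)"
proof (rule antisym)
  show "limiting_normal_cone xbar \<Omega> \<subseteq> critical_polar + range (adjoint_map dh)"
  proof
    fix x' assume "x' \<in> limiting_normal_cone xbar \<Omega>"
    then obtain xs \<epsilon> xs' where xs: "xs \<longlonglongrightarrow> xbar" and \<epsilon>: "\<epsilon> \<longlonglongrightarrow> 0"
      and normal: "\<And>n. xs' n \<in> frechet_subdifferential (\<epsilon> n) (set_indicator \<Omega>) (xs n)"
      and lim: "limitin weak_star xs' x' sequentially"
      unfolding limiting_normal_cone_def limiting_subdifferential_def by blast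
    have "xs n \<in> \<Omega>" for n using normal[of n] unfolding frechet_subdifferential_indicator_iff by blast
    then have "x' d \<le> 0" if "d \<in> critical_cone" "dh d = 0" for d
      using that limit_of_normals_nonpositive[OF subset_refl assms _ xs \<epsilon> normal limitin_weak_star_pointwise[OF lim]]
      by blast
    then show "x' \<in> critical_polar + range (adjoint_map dh)"
      by (rule nonpositive_on_kernel_decomposition)
  qed
  show "critical_polar + range (adjoint_map dh) \<subseteq> limiting_normal_cone xbar \<Omega>"
    using frechet_subset_limiting_normal_cone frechet_normal_cone_eq by blast
qed

end

section \<open>The normal cones\<close>

lemma PMFCQ_uniform_decrease:
  assumes "PMFCQ T g dg dh xbar"
  obtains xt \<epsilon> \<delta> where "dh xt = 0" "\<epsilon> > 0" "\<delta> > 0" "\<And>t. t \<in> active_indices T g xbar \<epsilon> \<Longrightarrow> dg t xt \<le> - \<delta>"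
proof -
  obtain xt where xt: "dh xt = 0" "(INF \<epsilon>\<in>{0<..}. SUP t\<in>active_indices T g xbar \<epsilon>. ereal (dg t xt)) < 0"
    using assms unfolding PMFCQ_def by blast
  then obtain \<epsilon> where \<epsilon>: "\<epsilon> > 0" and "(SUP t\<in>active_indices T g xbar \<epsilon>. ereal (dg t xt)) < 0"
    by (auto simp: INF_less_iff)
  then obtain z where z: "(SUP t\<in>active_indices T g xbar \<epsilon>. ereal (dg t xt)) < ereal z" "ereal z < 0"
    using ereal_dense2 by blast
  have "dg t xt \<le> - (- z)" if "t \<in> active_indices T g xbar \<epsilon>" for t
  proof -
    have "ereal (dg t xt) \<le> (SUP t\<in>active_indices T g xbar \<epsilon>. ereal (dg t xt))" using that by (rule SUP_upper)
    then have "ereal (dg t xt) < ereal z" using z(1) by (rule order_le_less_trans)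
    then show ?thesis by simp
  qed
  then show thesis using that[of xt \<epsilon> "- z"] xt(1) \<epsilon> z(2) by (simp add: zero_ereal_def)
qed

theorem theorem4p2:
  fixes T :: "'t set"
    and g :: "'t \<Rightarrow> 'x::banach \<Rightarrow> ereal"
    and h :: "'x \<Rightarrow> 'y::banach"
    and dg :: "'t \<Rightarrow> 'x \<Rightarrow>\<^sub>L real"
    and dh :: "'x \<Rightarrow>\<^sub>L 'y"
    and xbar :: 'x
    and \<Omega> :: "'x set"
  assumes "\<forall>t\<in>T. \<forall>x. g t x \<noteq> -\<infinity>"
    and "\<Omega> = feasible_set T g h"
    and "xbar \<in> \<Omega>"
    and "standing_assumptions T g h dg dh xbar"
    and "PMFCQ T g dg dh xbar"
    and "uniformly_frechet_differentiable T g dg xbar"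
  shows "frechet_normal_cone xbar \<Omega> =
           (\<Inter>\<epsilon>\<in>{0<..}. weak_star closure_of
              generated_cone (dg ` active_indices T g xbar \<epsilon>)) + range (adjoint_map dh) \<and>
         (uniformly_strictly_differentiable T g dg xbar \<longrightarrow>
          limiting_normal_cone xbar \<Omega> =
           (\<Inter>\<epsilon>\<in>{0<..}. weak_star closure_of
              generated_cone (dg ` active_indices T g xbar \<epsilon>)) + range (adjoint_map dh) \<and>
          normally_regular \<Omega> xbar)"
proof -
  have finite: "\<bar>g t u\<bar> \<noteq> \<infinity>" if "t \<in> T" "u \<in> \<Omega>" for t u
  proof -
    have "g t u \<le> 0" "g t u \<noteq> - \<infinity>" using that assms(1,2) by (auto simp: feasible_set_def)
    then show ?thesis by (cases "g t u") auto
  qed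
  obtain G0 where G0: "\<And>t. t \<in> T \<Longrightarrow> norm (dg t) \<le> G0"
    using assms(4) unfolding standing_assumptions_def bounded_iff by auto
  obtain xt \<epsilon>0 \<delta> where PMFCQ: "dh xt = 0" "\<epsilon>0 > 0" "\<delta> > 0"
      "\<And>t. t \<in> active_indices T g xbar \<epsilon>0 \<Longrightarrow> dg t xt \<le> - \<delta>"
    using PMFCQ_uniform_decrease[OF assms(5)] by blast
  interpret regular_system T g h dg dh xbar xt \<epsilon>0 \<delta> "max 0 G0"
  proof
    show "xbar \<in> feasible_set T g h" using assms(2,3) by simp
    show "has_strict_derivative h dh xbar" using assms(4) by (simp add: standing_assumptions_def)
    show "surj (blinfun_apply dh)" using assms(5) by (simp add: PMFCQ_def)
    show "norm (dg t) \<le> max 0 G0" if "t \<in> T" for t using G0[OF that] by simp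
    show "uniform_linearization T g dg xbar {xbar}"
      using assms(3,6) finite by (intro uniform_linearization_of_frechet) auto
  qed (use PMFCQ finite assms(3) in auto)
  have "limiting_normal_cone xbar \<Omega> = critical_polar + range (adjoint_map dh)"
    if "uniformly_strictly_differentiable T g dg xbar"
    using limiting_normal_cone_eq uniform_linearization_of_strict[OF that] finite assms(2) by blast
  then show ?thesis
    using frechet_normal_cone_eq assms(2) by (simp add: multipliers_eq_polar normally_regular_def)
qed

end
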